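(* Let $(\pi_n)_{n\ge 1}$ be a partition structure whose exchangeable partition probability function (EPPF) $p$ satisfies $$p(2,2,1)>0\quad\text{and}\quad \lim_{n\to\infty}p(n)=0 .$$ Then $p$ belongs to the extended two-parameter family if and only if $(\pi_n)$ has the following property: there exists a sequence of random partitions $(\pi'_1,\pi'_2,\ldots)$ ($\pi'_r$ being a random partition of the integer $r$), not depending on $n$, such that for all $1\le m<n$: if one of $n$ balls is chosen uniformly at random, independently of a random coloring of these balls according to $\pi_n$, then, conditionally given that the number of other balls of the same color as the chosen ball is $m-1$, the coloring (partition by color) of the remaining $n-m$ balls, obtained by deleting all balls of the color of the chosen ball, is distributed according to $\pi'_{n-m}$. Moreover, in this case: if $(\pi_n)$ has the $(\alpha,\theta)$ EPPF $p_{\alpha,\theta}$, then $(\pi'_n)$ has the $(\alpha,\theta+\alpha)$ EPPF $p_{\alpha,\theta+\alpha}$; and if $(\pi_n)$ has the coupon-collector EPPF $p_M$ for some $M$, then $(\pi'_n)$ has the EPPF $p_{M-1}$.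
   Context: A partition of a positive integer $n$ is a multiset of positive integers with sum $n$; it describes $n$ unordered balls colored so that the multiset of numbers of balls of each color is the given partition. A composition of $n$ is a finite sequence $\lambda=(\lambda_1,\dots,\lambda_k)$ of positive integers with sum $n$; write $k=k_\lambda$, $n=n_\lambda$. A random partition $\pi_n$ of $n$ is a random variable with values in the set of partitions of $n$. A partition structure is a sequence of (distributions of) random partitions $(\pi_n)_{n\ge1}$ that is sampling consistent: if a ball is picked uniformly at random and deleted from $n$ balls randomly colored according to $\pi_n$, then the coloring of the remaining $n-1$ balls is distributed according to $\pi_{n-1}$. EPPF: place the $n$ balls colored according to $\pi_n$ in a row by a uniformly random permutation, and let $\Pi_n$ be the resulting random partition of the set $[n]=\{1,\dots,n\}$ (blocks = sets of places of equal color). Then $\mathbb P(\Pi_n=\{B_1,\dots,B_k\})=p(|B_1|,\dots,|B_k|)$ for a symmetric function $p$ of compositions of $n$; this $p$, defined on compositions of all $n$, is the EPPF of $(\pi_n)$. Here $p(n)$ denotes the value at the one-part composition $(n)$. Rising factorial: $(x)_n=x(x+1)\cdots(x+n-1)$, $(x)_0=1$. The $(\alpha,\theta)$ EPPF is $$p_{\alpha,\theta}(\lambda)=\frac{\prod_{i=1}^{k-1}(\theta+i\alpha)}{(\theta+1)_{n-1}}\prod_{j=1}^{k}(1-\alpha)_{\lambda_j-1},\qquad k=k_\lambda,\ n=n_\lambda,$$ for parameters either with $0\le\alpha<1$, $\theta>-\alpha$, or with $\alpha<0$ and $\theta=-M\alpha$ for some positive integer $M$. The coupon-collector EPPF with parameter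 a positive integer $M$ is $$p_M(\lambda)=\frac{M(M-1)\cdots(M-k+1)}{M^n}.$$ The extended two-parameter family consists of all these functions $p_{\alpha,\theta}$ (both parameter ranges) and $p_M$. *)

theory Defs
  imports "HOL-Probability.Probability" "HOL-Combinatorics.Permutations"
    "HOL-Library.Disjoint_Sets" "HOL-Library.Multiset"
begin

definition partitions_of :: "nat \<Rightarrow> nat multiset set" where
  "partitions_of n = {\<mu>. 0 \<notin># \<mu> \<and> sum_mset \<mu> = n}"

definition random_partition :: "nat \<Rightarrow> nat multiset pmf \<Rightarrow> bool" where
  "random_partition n P \<longleftrightarrow> set_pmf P \<subseteq> partitions_of n"

definition color_partition :: "'b set \<Rightarrow> ('b \<Rightarrow> 'c) \<Rightarrow> nat multiset" where
  "color_partition B c = image_mset (\<lambda>j. card {b \<in> B. c b = j}) (mset_set (c ` B))"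

(* A coloring of the balls 1, ..., n with color class sizes \<mu>. Balls are only ever selected or
   permuted uniformly at random, so the distributions below do not depend on this choice. *)
definition coloring :: "nat multiset \<Rightarrow> nat \<Rightarrow> nat" where
  "coloring \<mu> = (SOME c. color_partition {1..sum_mset \<mu>} c = \<mu>)"

lemma color_partition_coloring:
  assumes "\<mu> \<in> partitions_of n"
  shows "color_partition {1..n} (coloring \<mu>) = \<mu>"
proof -
  have "0 \<notin># \<mu> \<Longrightarrow> \<exists>c::nat \<Rightarrow> nat. color_partition {1..sum_mset \<mu>} c = \<mu>"
  proof (induction \<mu>)
    case empty
    then show ?case by (simp add: color_partition_def)
  next
    case (add x \<mu>)
    let ?s = "sum_mset \<mu>"
    from add obtain c :: "nat \<Rightarrow> nat" where c: "color_partition {1..?s} c = \<mu>" by auto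
    have x: "x > 0" using add.prems by (cases x) auto
    define z where "z = Suc (Max (insert 0 (c ` {1..?s})))"
    have z: "c b \<noteq> z" if "b \<in> {1..?s}" for b
    proof -
      have "c b \<le> Max (insert 0 (c ` {1..?s}))" using that by (intro Max_ge) auto
      then show ?thesis by (simp add: z_def)
    qed
    define d where "d b = (if b \<le> ?s then c b else z)" for b
    have new: "{b \<in> {1..?s + x}. d b = z} = {?s+1..?s+x}"
    proof -
      have "d b = z \<longleftrightarrow> ?s < b" if "1 \<le> b" for b
        using z[of b] that by (simp add: d_def)
      note iff = this
      show ?thesis
      proof (rule set_eqI)
        fix b show "b \<in> {b \<in> {1..?s + x}. d b = z} \<longleftrightarrow> b \<in> {?s+1..?s+x}"
          using iff[of b] by (cases "1 \<le> b") auto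
      qed
    qed
    have old: "{b \<in> {1..?s + x}. d b = j} = {b \<in> {1..?s}. c b = j}" if "j \<noteq> z" for j
      using that by (auto simp: d_def split: if_splits)
    have im: "d ` {1..?s + x} = insert z (c ` {1..?s})"
    proof -
      have "{1..?s + x} = {1..?s} \<union> {?s+1..?s+x}" by auto
      moreover have "d ` {1..?s} = c ` {1..?s}" by (auto simp: d_def)
      moreover have "d ` {?s+1..?s+x} = {z}"
      proof -
        have "d ` {?s+1..?s+x} = (\<lambda>b. z) ` {?s+1..?s+x}"
          by (rule image_cong) (auto simp: d_def)
        then show ?thesis using x by (simp add: image_constant_conv)
      qed
      ultimately show ?thesis by (auto simp: image_Un)
    qed
    have zn: "z \<notin> c ` {1..?s}"
    proof
      assume "z \<in> c ` {1..?s}"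
      then obtain b where "b \<in> {1..?s}" "z = c b" by (rule imageE) simp
      then show False using z[of b] by simp
    qed
    have "color_partition {1..?s + x} d = add_mset x
        (image_mset (\<lambda>j. card {b \<in> {1..?s + x}. d b = j}) (mset_set (c ` {1..?s})))"
      unfolding color_partition_def im using zn new by simp
    also have "image_mset (\<lambda>j. card {b \<in> {1..?s + x}. d b = j}) (mset_set (c ` {1..?s})) =
        color_partition {1..?s} c"
      unfolding color_partition_def
    proof (rule image_mset_cong)
      fix j assume "j \<in># mset_set (c ` {1..?s})"
      then have "j \<noteq> z" using zn by auto
      then show "card {b \<in> {1..?s + x}. d b = j} = card {b \<in> {1..?s}. c b = j}"
        using old by simp
    qed
    finally have "color_partition {1..?s + x} d = add_mset x \<mu>" using c by simp
    then show ?case by (auto simp: add.commute)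
  qed
  then have "\<exists>c::nat \<Rightarrow> nat. color_partition {1..sum_mset \<mu>} c = \<mu>"
    using assms by (simp add: partitions_of_def)
  then have "color_partition {1..sum_mset \<mu>} (coloring \<mu>) = \<mu>"
    unfolding coloring_def by (rule someI_ex)
  then show ?thesis
    using assms by (simp add: partitions_of_def)
qed

definition delete_ball :: "nat \<Rightarrow> nat multiset pmf \<Rightarrow> nat multiset pmf" where
  "delete_ball n P =
     map_pmf (\<lambda>(\<mu>, b). color_partition ({1..n} - {b}) (coloring \<mu>))
       (pair_pmf P (pmf_of_set {1..n}))"

(* Sequences are indexed by n \<ge> 1; the value at index 0 is irrelevant throughout. *)
definition partition_structure :: "(nat \<Rightarrow> nat multiset pmf) \<Rightarrow> bool" where
  "partition_structure \<pi> \<longleftrightarrow>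
     (\<forall>n\<ge>1. random_partition n (\<pi> n)) \<and> (\<forall>n\<ge>2. delete_ball n (\<pi> n) = \<pi> (n - 1))"

(* Ball b is put at place \<sigma> b. *)
definition exchangeable_partition :: "nat \<Rightarrow> nat multiset pmf \<Rightarrow> nat set set pmf" where
  "exchangeable_partition n P =
     map_pmf (\<lambda>(\<mu>, \<sigma>). (\<lambda>j. \<sigma> ` {b \<in> {1..n}. coloring \<mu> b = j}) ` (coloring \<mu> ` {1..n}))
       (pair_pmf P (pmf_of_set {\<sigma>. \<sigma> permutes {1..n}}))"

(* Functions of compositions are represented as functions on all lists, of which only the values
   at compositions matter. Bs ranges over all enumerations of the blocks of a set partition. *)
definition is_EPPF :: "(nat \<Rightarrow> nat multiset pmf) \<Rightarrow> (nat list \<Rightarrow> real) \<Rightarrow> bool" where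
  "is_EPPF \<pi> p \<longleftrightarrow>
     (\<forall>n\<ge>1. \<forall>Bs. distinct Bs \<and> partition_on {1..n} (set Bs) \<longrightarrow>
        pmf (exchangeable_partition n (\<pi> n)) (set Bs) = p (map card Bs))"

definition composition :: "nat list \<Rightarrow> bool" where
  "composition l \<longleftrightarrow> l \<noteq> [] \<and> 0 \<notin> set l"

definition two_parameter_EPPF :: "real \<Rightarrow> real \<Rightarrow> nat list \<Rightarrow> real" where
  "two_parameter_EPPF \<alpha> \<theta> l =
     (\<Prod>i = 1..<length l. \<theta> + real i * \<alpha>) / pochhammer (\<theta> + 1) (sum_list l - 1)
       * (\<Prod>x\<leftarrow>l. pochhammer (1 - \<alpha>) (x - 1))"

definition two_parameter_range :: "real \<Rightarrow> real \<Rightarrow> bool" where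
  "two_parameter_range \<alpha> \<theta> \<longleftrightarrow>
     (0 \<le> \<alpha> \<and> \<alpha> < 1 \<and> \<theta> > - \<alpha>) \<or> (\<alpha> < 0 \<and> (\<exists>M::nat. M \<ge> 1 \<and> \<theta> = - real M * \<alpha>))"

definition coupon_EPPF :: "nat \<Rightarrow> nat list \<Rightarrow> real" where
  "coupon_EPPF M l = (\<Prod>i<length l. real M - real i) / real M ^ sum_list l"

definition extended_two_parameter_family :: "(nat list \<Rightarrow> real) \<Rightarrow> bool" where
  "extended_two_parameter_family p \<longleftrightarrow>
     (\<exists>\<alpha> \<theta>. two_parameter_range \<alpha> \<theta> \<and> (\<forall>l. composition l \<longrightarrow> p l = two_parameter_EPPF \<alpha> \<theta> l)) \<or>
     (\<exists>M\<ge>1. \<forall>l. composition l \<longrightarrow> p l = coupon_EPPF M l)"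

(* The joint distribution, for a uniformly chosen ball b, of the number of other balls of the
   color of b and the partition by color of the balls not of the color of b. *)
definition delete_color :: "nat \<Rightarrow> nat multiset pmf \<Rightarrow> (nat \<times> nat multiset) pmf" where
  "delete_color n P =
     map_pmf (\<lambda>(\<mu>, b).
         (card {i \<in> {1..n} - {b}. coloring \<mu> i = coloring \<mu> b},
          color_partition {i \<in> {1..n}. coloring \<mu> i \<noteq> coloring \<mu> b} (coloring \<mu>)))
       (pair_pmf P (pmf_of_set {1..n}))"

(* The nonemptiness guard restricts the conditioning to events of positive probability;
   cond_pmf is meaningful only for those. *)
definition color_deletion_property ::
    "(nat \<Rightarrow> nat multiset pmf) \<Rightarrow> (nat \<Rightarrow> nat multiset pmf) \<Rightarrow> bool" where
  "color_deletion_property \<pi> \<pi>' \<longleftrightarrow>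
     (\<forall>r\<ge>1. random_partition r (\<pi>' r)) \<and>
     (\<forall>m n. 1 \<le> m \<and> m < n \<and> set_pmf (delete_color n (\<pi> n)) \<inter> {x. fst x = m - 1} \<noteq> {} \<longrightarrow>
        map_pmf snd (cond_pmf (delete_color n (\<pi> n)) {x. fst x = m - 1}) = \<pi>' (n - m))"

end

theory Submission
  imports Defs
begin

text \<open>
  Write \<open>p(\<mu>)\<close> for the value of the EPPF at a multiset \<open>\<mu>\<close> of block sizes. Double counting of set
  partitions with a marked block turns sampling consistency into the addition rule
  \<open>p(\<nu>) = (\<Sum>y\<in>#\<nu>. p(\<nu> - {y} + {y + 1})) + p(\<nu> + {1})\<close>, and the deletion property into the
  factorization \<open>p({m} + \<rho>) = Z(m, |\<rho>|) q(\<rho>)\<close>, with \<open>q\<close> the EPPF of \<open>\<pi>'\<close>. The two-parameter and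
  coupon-collector functions visibly factorize in this way, which gives one direction and identifies \<open>q\<close>.

  Conversely, if \<open>p\<close> factorizes, then as soon as there are two blocks the conditional probability \<open>\<gamma> a n\<close>
  that the next ball joins a given block of size \<open>a\<close> depends only on \<open>a\<close> and the number \<open>n\<close> of balls,
  as in Johnson's sufficientness postulate. Comparing the two orders of adding two balls shows
  that \<open>\<gamma> a n\<close> is linear in \<open>a\<close>; its slope is nonnegative because indicators of an infinite exchangeable
  sequence are nonnegatively correlated. Hence either \<open>\<gamma> a n = (a - \<alpha>) / (n + \<theta>)\<close> or \<open>\<gamma>\<close>
  is constant. This determines \<open>p\<close> on partitions with at least two blocks up to a factor; the
  factor and the values \<open>p(n)\<close> follow from \<open>p(n) - p(n + 1) = p(n, 1)\<close> and \<open>p(n) \<rightarrow> 0\<close>, where divergence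
  of the harmonic series forces \<open>\<theta> > -\<alpha>\<close>.
\<close>

section \<open>Counting set partitions of a given type\<close>

definition block_sizes :: "'a set set \<Rightarrow> nat multiset" where
  "block_sizes P = image_mset card (mset_set P)"

definition set_partitions_of_type :: "'a set \<Rightarrow> nat multiset \<Rightarrow> 'a set set set" where
  "set_partitions_of_type A \<mu> = {P. partition_on A P \<and> block_sizes P = \<mu>}"

text \<open>The standard ground set makes this a function of the type alone. For positive parts it
  is n! divided by the factorials of all parts and of all multiplicities; it is the factor between
  the law of a random partition and its EPPF.\<close>

definition type_count :: "nat multiset \<Rightarrow> nat" where
  "type_count \<mu> = card (set_partitions_of_type {1..sum_mset \<mu>} \<mu>)"

lemma finite_set_partitions_of_type:
  "finite A \<Longrightarrow> finite (set_partitions_of_type A \<mu>)"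
  by (rule finite_subset[OF _ finitely_many_partition_on[of A]])
     (auto simp: set_partitions_of_type_def)

lemma partition_on_finite_block: "finite A \<Longrightarrow> partition_on A P \<Longrightarrow> B \<in> P \<Longrightarrow> finite B"
  by (metis Union_upper finite_subset partition_onD1)

lemma sum_block_sizes:
  assumes "finite A" "partition_on A P"
  shows "sum_mset (block_sizes P) = card A"
  using assms
  by (simp add: block_sizes_def partition_onD1[OF assms(2)] card_Union_disjoint
      partition_onD2 partition_on_finite_block sum_unfold_sum_mset)

lemma zero_notin_block_sizes:
  assumes "finite A" "partition_on A P"
  shows "0 \<notin># block_sizes P"
  using assms finite_elements[OF assms] partition_on_finite_block[OF assms] partition_onD3[OF assms(2)]
  by (auto simp: block_sizes_def)

lemma block_sizes_in_partitions_of: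
  "partition_on {1..n} P \<Longrightarrow> block_sizes P \<in> partitions_of n"
  using sum_block_sizes[of "{1..n}" P] zero_notin_block_sizes[of "{1..n}" P]
  by (simp add: partitions_of_def)

lemma image_image_set_partitions_of_type:
  assumes "bij_betw h A B" "finite A" "P \<in> set_partitions_of_type A \<mu>"
  shows "(`) h ` P \<in> set_partitions_of_type B \<mu>"
proof -
  have P: "partition_on A P" and t: "block_sizes P = \<mu>"
    using assms by (auto simp: set_partitions_of_type_def)
  have inj: "inj_on h A" and im: "h ` A = B" using assms by (auto simp: bij_betw_def)
  have sub: "C \<subseteq> A" if "C \<in> P" for C using P that by (auto dest: partition_onD1)
  have inj2: "inj_on ((`) h) P"
    using inj sub by (meson inj_on_image_eq_iff inj_onI)
  have "partition_on (h ` A) ((`) h ` P)"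
    using partition_on_inj_image[OF P inj] partition_onD3[OF P] by (simp add: image_iff)
  moreover have "block_sizes ((`) h ` P) = block_sizes P"
    unfolding block_sizes_def image_mset_mset_set[OF inj2, symmetric] multiset.map_comp
    using sub inj finite_elements[OF assms(2) P]
    by (intro image_mset_cong) (auto intro!: card_image intro: inj_on_subset)
  ultimately show ?thesis using t im by (simp add: set_partitions_of_type_def)
qed

text \<open>A bijection of ground sets maps set partitions injectively to set partitions of the same
  type. A bijection onto the standard set and its inverse give the two inequalities.\<close>

lemma card_set_partitions_of_type:
  assumes "finite A" "card A = sum_mset \<mu>"
  shows "card (set_partitions_of_type A \<mu>) = type_count \<mu>"
proof -
  have le: "card (set_partitions_of_type X \<mu>) \<le> card (set_partitions_of_type Y \<mu>)"
    if h: "bij_betw h X Y" and X: "finite X" for h :: "'x \<Rightarrow> 'y" and X Y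
  proof (rule card_inj_on_le)
    have inj: "inj_on h X" using h by (simp add: bij_betw_def)
    show "inj_on ((`) ((`) h)) (set_partitions_of_type X \<mu>)"
    proof (rule inj_onI)
      fix P Q assume PQ: "P \<in> set_partitions_of_type X \<mu>" "Q \<in> set_partitions_of_type X \<mu>"
        and eq: "(`) h ` P = (`) h ` Q"
      have sub: "P \<subseteq> Pow X" "Q \<subseteq> Pow X"
        using PQ by (auto simp: set_partitions_of_type_def dest: partition_onD1)
      show "P = Q" using eq inj_on_image_eq_iff[OF inj_on_image_Pow[OF inj] sub] by simp
    qed
    show "(`) ((`) h) ` set_partitions_of_type X \<mu> \<subseteq> set_partitions_of_type Y \<mu>"
      using image_image_set_partitions_of_type[OF h X] by blast
    show "finite (set_partitions_of_type Y \<mu>)"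
      using bij_betw_finite[OF h] X by (intro finite_set_partitions_of_type) simp
  qed
  obtain h where h: "bij_betw h A {1..sum_mset \<mu>}"
    using finite_same_card_bij[of A "{1..sum_mset \<mu>}"] assms by auto
  show ?thesis
    unfolding type_count_def using le[OF h assms(1)] le[OF bij_betw_inv_into[OF h]] by simp
qed

lemma type_count_empty: "type_count {#} = 1"
proof -
  have "set_partitions_of_type ({1..0} :: nat set) {#} = {{}}"
    by (auto simp: set_partitions_of_type_def block_sizes_def partition_on_empty)
  then show ?thesis by (simp add: type_count_def)
qed

text \<open>Both sides count the set partitions of the given type with a marked block of size \<open>m\<close>.\<close>
lemma type_count_add_mset:
  assumes "m \<ge> 1"
  shows "type_count (add_mset m \<rho>) * Suc (count \<rho> m) = (m + sum_mset \<rho> choose m) * type_count \<rho>"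
proof -
  define X where "X = {1..m + sum_mset \<rho>}"
  let ?L = "SIGMA P : set_partitions_of_type X (add_mset m \<rho>). {B \<in> P. card B = m}"
  let ?R = "SIGMA B : {B. B \<subseteq> X \<and> card B = m}. set_partitions_of_type (X - B) \<rho>"
  have fX: "finite X" by (simp add: X_def)
  have "bij_betw (\<lambda>(P, B). (B, P - {B})) ?L ?R"
  proof (rule bij_betw_byWitness[where f' = "\<lambda>(B, P). (insert B P, B)"])
    show "\<forall>a\<in>?L. (\<lambda>(B, P). (insert B P, B)) ((\<lambda>(P, B). (B, P - {B})) a) = a"
      by (auto simp: insert_absorb)
    show "\<forall>a\<in>?R. (\<lambda>(P, B). (B, P - {B})) ((\<lambda>(B, P). (insert B P, B)) a) = a"
    proof (clarsimp split: prod.splits)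
      fix B P assume B: "B \<subseteq> X" "m = card B" and P: "P \<in> set_partitions_of_type (X - B) \<rho>"
      \<comment> \<open>This is where \<open>m \<ge> 1\<close> enters: a nonempty marked block
        cannot also be a block of a partition of its complement, so inserting and then removing it
        changes nothing.\<close>
      have "B \<noteq> {}" using assms B by auto
      have "B \<notin> P"
      proof
        assume "B \<in> P"
        then have "B \<subseteq> X - B" using P by (auto simp: set_partitions_of_type_def dest: partition_onD1)
        then show False using \<open>B \<noteq> {}\<close> by auto
      qed
      then show "P - {B} = P" by simp
    qed
    show "(\<lambda>(P, B). (B, P - {B})) ` ?L \<subseteq> ?R"
    proof (rule image_subsetI)
      fix x assume "x \<in> ?L"
      then obtain P B where x: "x = (P, B)" and P: "P \<in> set_partitions_of_type X (add_mset m \<rho>)"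
        and B: "B \<in> P" "m = card B" by blast
      have pP: "partition_on X P" and tP: "block_sizes P = add_mset (card B) \<rho>"
        using P B by (auto simp: set_partitions_of_type_def)
      have fP: "finite P" using finite_elements[OF fX pP] .
      have ins: "insert B (P - {B}) = P" using B by auto
      have dis: "disjnt B C" if "C \<in> P - {B}" for C
        using partition_onD2[OF pP] B that by (auto simp: disjoint_def disjnt_def)
      have sub: "B \<subseteq> X" using pP B by (auto dest: partition_onD1)
      have "X = B \<union> \<Union>(P - {B})" using partition_onD1[OF pP] B by auto
      moreover have "B \<inter> \<Union>(P - {B}) = {}" using dis by (auto simp: disjnt_def)
      ultimately have "X - B = \<Union>(P - {B})" by auto
      then have "partition_on (X - B) (P - {B})"
        using pP by (auto simp: partition_on_def disjoint_def)
      moreover have "block_sizes (P - {B}) = \<rho>"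
      proof -
        have "mset_set P = add_mset B (mset_set (P - {B}))"
          using fP B by (subst ins[symmetric], subst mset_set.insert) auto
        then show ?thesis using tP by (simp add: block_sizes_def)
      qed
      ultimately show "(case x of (P, B) \<Rightarrow> (B, P - {B})) \<in> ?R"
        using sub B by (auto simp: set_partitions_of_type_def x)
    qed
    show "(\<lambda>(B, P). (insert B P, B)) ` ?R \<subseteq> ?L"
    proof (rule image_subsetI)
      fix x assume "x \<in> ?R"
      then obtain B P where x: "x = (B, P)" and B: "B \<subseteq> X" "m = card B"
        and P: "P \<in> set_partitions_of_type (X - B) \<rho>" by blast
      have pP: "partition_on (X - B) P" and tP: "block_sizes P = \<rho>"
        using P by (auto simp: set_partitions_of_type_def)
      have "B \<noteq> {}" using assms B by auto
      have sub: "C \<subseteq> X - B" if "C \<in> P" for C using that pP by (auto dest: partition_onD1)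
      have nB: "B \<notin> P" using sub[of B] \<open>B \<noteq> {}\<close> by auto
      have "partition_on X (insert B P)"
        unfolding partition_on_def
      proof (intro conjI)
        show "\<Union>(insert B P) = X" using partition_onD1[OF pP] B by auto
        show "disjoint (insert B P)"
          using partition_onD2[OF pP] sub by (fastforce simp: disjoint_def)
        show "{} \<notin> insert B P" using \<open>B \<noteq> {}\<close> partition_onD3[OF pP] by auto
      qed
      moreover have "finite P" using finite_elements[OF _ pP] fX by simp
      then have "block_sizes (insert B P) = add_mset (card B) \<rho>"
        using nB tP by (simp add: block_sizes_def)
      ultimately show "(case x of (B, P) \<Rightarrow> (insert B P, B)) \<in> ?L"
        using B by (auto simp: set_partitions_of_type_def x)
    qed
  qed
  then have "card ?L = card ?R" by (rule bij_betw_same_card)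
  moreover have "card ?L = type_count (add_mset m \<rho>) * Suc (count \<rho> m)"
  proof -
    \<comment> \<open>The number of ways to mark a block of size \<open>m\<close> is the same for
      every partition of this type.\<close>
    have "card {B \<in> P. card B = m} = Suc (count \<rho> m)"
      if "P \<in> set_partitions_of_type X (add_mset m \<rho>)" for P
    proof -
      have "partition_on X P" and t: "block_sizes P = add_mset m \<rho>"
        using that by (auto simp: set_partitions_of_type_def)
      then have "finite P" using finite_elements fX by blast
      then have "count (block_sizes P) m = card {B \<in> P. card B = m}"
        by (simp add: block_sizes_def count_image_mset' conj_commute eq_commute[of m])
      then show ?thesis by (simp add: t)
    qed
    moreover have "finite P" if "P \<in> set_partitions_of_type X (add_mset m \<rho>)" for P
      using that finite_elements[OF fX] by (auto simp: set_partitions_of_type_def)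
    ultimately show ?thesis
      using card_set_partitions_of_type[OF fX, of "add_mset m \<rho>"] fX
      by (subst card_SigmaI) (auto simp: X_def finite_set_partitions_of_type)
  qed
  moreover have "card ?R = (m + sum_mset \<rho> choose m) * type_count \<rho>"
  proof -
    have "card (set_partitions_of_type (X - B) \<rho>) = type_count \<rho>" if "B \<subseteq> X" "card B = m" for B
      using that fX by (intro card_set_partitions_of_type) (auto simp: card_Diff_subset finite_subset X_def)
    then show ?thesis
      using fX by (subst card_SigmaI) (auto simp: n_subsets finite_set_partitions_of_type X_def)
  qed
  ultimately show ?thesis by simp
qed

lemma type_count_pos: "0 \<notin># \<mu> \<Longrightarrow> type_count \<mu> > 0"
proof (induction \<mu>)
  case empty
  then show ?case by (simp add: type_count_empty)
next
  case (add m \<mu>)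
  then have "m \<ge> 1" by (cases m) auto
  from type_count_add_mset[OF this, of \<mu>] add have "type_count (add_mset m \<mu>) * Suc (count \<mu> m) > 0"
    by (simp add: not_le)
  then show ?case by (cases "type_count (add_mset m \<mu>)") auto
qed

section \<open>The action of permutations on set partitions of one type\<close>

lemma enumerate_set_partition:
  assumes "finite A" "P \<in> set_partitions_of_type A (mset l)"
  obtains Bs where "distinct Bs" "set Bs = P" "map card Bs = l"
proof -
  have "finite P" using assms finite_elements by (auto simp: set_partitions_of_type_def)
  then obtain xs where xs: "set xs = P" "distinct xs" using finite_distinct_list by blast
  have "mset l = mset (map card xs)"
    using assms xs mset_set_set[OF xs(2)] by (auto simp: set_partitions_of_type_def block_sizes_def)
  then obtain q where q: "q permutes {..<length xs}" "permute_list q (map card xs) = l"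
    using mset_eq_permutation[of l "map card xs"] by auto
  show thesis
  proof (rule that)
    show "distinct (permute_list q xs)" using xs q by simp
    show "set (permute_list q xs) = P" using xs q by simp
    show "map card (permute_list q xs) = l" using q by (simp add: permute_list_map)
  qed
qed

text \<open>List the blocks of \<open>P\<close> and \<open>Q\<close> with the same sequence of sizes
  and label each element by the index of its block. Both labelings use every label equally often, so
  a permutation of \<open>A\<close> carries one to the other.\<close>

lemma set_partitions_of_type_transitive:
  assumes "finite A" "P \<in> set_partitions_of_type A \<mu>" "Q \<in> set_partitions_of_type A \<mu>"
  obtains \<tau> where "\<tau> permutes A" "(`) \<tau> ` P = Q"
proof -
  obtain l where l: "\<mu> = mset l" using ex_mset by metis
  obtain Bs where Bs: "distinct Bs" "set Bs = P" "map card Bs = l"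
    using enumerate_set_partition assms l by metis
  obtain Cs where Cs: "distinct Cs" "set Cs = Q" "map card Cs = l"
    using enumerate_set_partition assms l by metis
  define idx where "idx Ds x = (THE i. i < length Ds \<and> x \<in> Ds ! i)" for Ds and x :: 'a
  have idx: "idx Ds x < length Ds \<and> (\<forall>i<length Ds. x \<in> Ds ! i \<longleftrightarrow> i = idx Ds x)"
    if "partition_on A (set Ds)" "distinct Ds" "x \<in> A" for Ds x
  proof -
    have "\<exists>!i. i < length Ds \<and> x \<in> Ds ! i"
    proof -
      obtain D where "D \<in> set Ds" "x \<in> D"
        using \<open>x \<in> A\<close> partition_onD1[OF \<open>partition_on A (set Ds)\<close>] by auto
      then obtain i where "i < length Ds" "x \<in> Ds ! i" by (metis in_set_conv_nth)
      moreover have "i = j" if "i < length Ds" "x \<in> Ds ! i" "j < length Ds" "x \<in> Ds ! j" for i j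
      proof (rule ccontr)
        assume "i \<noteq> j"
        then have "Ds ! i \<noteq> Ds ! j" using that \<open>distinct Ds\<close> by (simp add: nth_eq_iff_index_eq)
        then have "Ds ! i \<inter> Ds ! j = {}"
          using disjointD[OF partition_onD2[OF \<open>partition_on A (set Ds)\<close>]] that nth_mem by blast
        then show False using that by blast
      qed
      ultimately show ?thesis by blast
    qed
    then have "(THE i. i < length Ds \<and> x \<in> Ds ! i) < length Ds \<and> x \<in> Ds ! (THE i. i < length Ds \<and> x \<in> Ds ! i)"
      by (rule theI')
    with \<open>\<exists>!i. i < length Ds \<and> x \<in> Ds ! i\<close> show ?thesis unfolding idx_def by blast
  qed
  have pP: "partition_on A (set Bs)" and pQ: "partition_on A (set Cs)"
    using assms Bs Cs by (auto simp: set_partitions_of_type_def)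
  have fiber: "{x \<in> A. idx Ds x = i} = (if i < length Ds then Ds ! i else {})"
    if "partition_on A (set Ds)" "distinct Ds" for Ds i
  proof (intro set_eqI iffI)
    fix x assume "x \<in> {x \<in> A. idx Ds x = i}"
    then show "x \<in> (if i < length Ds then Ds ! i else {})" using idx[OF that, of x] by auto
  next
    fix x assume "x \<in> (if i < length Ds then Ds ! i else {})"
    then have i: "i < length Ds" "x \<in> Ds ! i" by (auto split: if_splits)
    then have "x \<in> A" using partition_onD1[OF that(1)] nth_mem[OF i(1)] by blast
    then show "x \<in> {x \<in> A. idx Ds x = i}" using idx[OF that, of x] i by auto
  qed
  have cnt: "count (image_mset (idx Ds) (mset_set A)) i = card {x \<in> A. idx Ds x = i}" for Ds i
    using assms(1) by (simp add: count_image_mset' eq_commute)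
  have len: "length Bs = length Cs" "\<And>i. i < length Bs \<Longrightarrow> card (Bs ! i) = card (Cs ! i)"
    using Bs(3) Cs(3) by (metis length_map, metis length_map nth_map)
  have "image_mset (idx Bs) (mset_set A) = image_mset (idx Cs) (mset_set A)"
    by (rule multiset_eqI) (use len in \<open>simp add: cnt fiber[OF pP Bs(1)] fiber[OF pQ Cs(1)]\<close>)
  from image_mset_eq_implies_permutes[OF assms(1) this]
  obtain \<tau> where \<tau>: "\<tau> permutes A" "\<forall>x\<in>A. idx Bs x = idx Cs (\<tau> x)" by metis
  have im: "\<tau> ` (Bs ! i) = Cs ! i" if i: "i < length Bs" for i
  proof -
    have "\<tau> ` {x \<in> A. idx Bs x = i} = {x \<in> A. idx Cs x = i}"
    proof (intro set_eqI iffI)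
      fix y assume y: "y \<in> {x \<in> A. idx Cs x = i}"
      then obtain x where "x \<in> A" "y = \<tau> x" using permutes_image[OF \<tau>(1)] by blast
      then show "y \<in> \<tau> ` {x \<in> A. idx Bs x = i}" using y \<tau>(2) by auto
    qed (use \<tau> permutes_in_image[OF \<tau>(1)] in auto)
    then show ?thesis using i len by (simp add: fiber[OF pP Bs(1)] fiber[OF pQ Cs(1)])
  qed
  have "(`) \<tau> ` set Bs = set Cs"
    using im len(1) by (fastforce simp: set_conv_nth image_iff)
  then show thesis using that \<tau>(1) Bs Cs by simp
qed

text \<open>Composition with a permutation that maps \<open>P\<close> to \<open>Q\<close> preserves
  the uniform distribution on the permutations and turns the event that \<open>P\<close> is hit into
  the event that \<open>Q\<close> is hit. By transitivity all partitions of the type are therefore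
  equally likely.\<close>

lemma map_pmf_permutation_action:
  assumes "finite A" "P \<in> set_partitions_of_type A \<mu>"
  shows "map_pmf (\<lambda>\<sigma>. (`) \<sigma> ` P) (pmf_of_set {\<sigma>. \<sigma> permutes A}) =
    pmf_of_set (set_partitions_of_type A \<mu>)" (is "?D = _")
proof -
  let ?G = "{\<sigma>. \<sigma> permutes A}" and ?T = "set_partitions_of_type A \<mu>"
  have fG: "finite ?G" "?G \<noteq> {}" using assms(1) finite_permutations[of A] permutes_id[of A] by blast+
  have fT: "finite ?T" "?T \<noteq> {}" using assms finite_set_partitions_of_type by auto
  have supp: "set_pmf ?D \<subseteq> ?T"
    using fG image_image_set_partitions_of_type[OF permutes_imp_bij assms] by (auto simp: set_map_pmf)
  have eq: "pmf ?D Q = pmf ?D P" if Q: "Q \<in> ?T" for Q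
  proof -
    obtain \<tau> where \<tau>: "\<tau> permutes A" "(`) \<tau> ` P = Q"
      using set_partitions_of_type_transitive[OF assms Q] by metis
    have \<tau>_eq: "(`) (\<tau> \<circ> \<sigma>) ` P = Q \<longleftrightarrow> (`) \<sigma> ` P = P" for \<sigma>
    proof -
      have "inj ((`) ((`) \<tau>))" using permutes_inj[OF \<tau>(1)] by (simp add: inj_image_eq_iff inj_def)
      moreover have "(`) (\<tau> \<circ> \<sigma>) ` P = (`) \<tau> ` ((`) \<sigma> ` P)" by (simp add: image_image image_comp)
      ultimately show ?thesis using \<tau>(2) by (metis injD)
    qed
    have "bij_betw ((\<circ>) \<tau>) ?G ?G"
      using \<tau>(1) permutes_inv[OF \<tau>(1)]
      by (intro bij_betw_byWitness[where f' = "(\<circ>) (inv \<tau>)"])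
         (auto simp: fun_eq_iff permutes_inverses intro: permutes_compose)
    then have "pmf_of_set ?G = map_pmf ((\<circ>) \<tau>) (pmf_of_set ?G)"
      using fG by (simp add: map_pmf_of_set_bij_betw)
    then have "?D = map_pmf (\<lambda>\<sigma>. (`) \<sigma> ` P) (map_pmf ((\<circ>) \<tau>) (pmf_of_set ?G))"
      by (rule arg_cong)
    then have "pmf ?D Q = pmf (map_pmf (\<lambda>\<sigma>. (`) (\<tau> \<circ> \<sigma>) ` P) (pmf_of_set ?G)) Q"
      by (simp only: map_pmf_comp)
    also have "\<dots> = pmf ?D P"
      by (simp only: pmf_map vimage_def singleton_iff \<tau>_eq)
    finally show ?thesis .
  qed
  have "(\<Sum>Q\<in>?T. pmf ?D Q) = 1" using sum_pmf_eq_1[OF fT(1) supp] .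
  then have "card ?T * pmf ?D P = 1" using eq by simp
  then have P: "pmf ?D P = 1 / card ?T" using fT by (simp add: field_simps)
  show ?thesis
  proof (rule pmf_eqI)
    fix Q show "pmf ?D Q = pmf (pmf_of_set ?T) Q"
    proof (cases "Q \<in> ?T")
      case True
      then show ?thesis using eq P fT by simp
    next
      case False
      then show ?thesis using supp fT by (auto simp: pmf_eq_0_set_pmf)
    qed
  qed
qed

section \<open>Distributions of random partitions in terms of the EPPF\<close>

lemma partition_on_color_classes:
  "partition_on B ((\<lambda>j. {b \<in> B. c b = j}) ` c ` B)"
  by (auto simp: partition_on_def disjoint_def)

lemma color_partition_eq_block_sizes:
  "color_partition B c = block_sizes ((\<lambda>j. {b \<in> B. c b = j}) ` c ` B)"
proof -
  have "inj_on (\<lambda>j. {b \<in> B. c b = j}) (c ` B)" by (auto simp: inj_on_def)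
  then show ?thesis
    unfolding color_partition_def block_sizes_def
    by (subst image_mset_mset_set[symmetric]) (auto simp: multiset.map_comp comp_def)
qed

lemma map_pmf_pair_pmf:
  "map_pmf (\<lambda>(x, y). F x y) (pair_pmf P Q) = bind_pmf P (\<lambda>x. map_pmf (F x) Q)"
  by (simp add: pair_pmf_def map_bind_pmf map_pmf_def bind_assoc_pmf bind_return_pmf)

text \<open>For two-stage experiments whose final outcome \<open>i\<close> reveals the outcome
  \<open>a\<close> of the first stage.\<close>

lemma pmf_bind_single:
  assumes "\<And>x. x \<in> set_pmf P \<Longrightarrow> pmf (K x) i = (if x = a then v else 0)"
  shows "pmf (bind_pmf P K) i = pmf P a * v"
proof -
  have "pmf (bind_pmf P K) i = (\<integral>x. v * indicator {a} x \<partial>P)"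
    unfolding pmf_bind using assms by (intro integral_cong_AE) (auto simp: AE_measure_pmf_iff)
  then show ?thesis by (simp add: measure_pmf_single)
qed

text \<open>Given the sizes, the random placement is uniform over the set partitions of that type,
  and \<open>S\<close> can arise only from its own type.\<close>

lemma pmf_exchangeable_partition:
  assumes "random_partition n P" "partition_on {1..n} S"
  shows "pmf (exchangeable_partition n P) S = pmf P (block_sizes S) / type_count (block_sizes S)"
proof -
  let ?C = "\<lambda>\<mu>. (\<lambda>j. {b \<in> {1..n}. coloring \<mu> b = j}) ` (coloring \<mu> ` {1..n})"
  have S: "S \<in> set_partitions_of_type {1..n} (block_sizes S)"
    using assms by (simp add: set_partitions_of_type_def)
  have "exchangeable_partition n P =
      bind_pmf P (\<lambda>\<mu>. map_pmf (\<lambda>\<sigma>. (`) \<sigma> ` ?C \<mu>) (pmf_of_set {\<sigma>. \<sigma> permutes {1..n}}))"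
    unfolding exchangeable_partition_def map_pmf_pair_pmf image_image ..
  also have "pmf \<dots> S = pmf P (block_sizes S) * (1 / type_count (block_sizes S))"
  proof (rule pmf_bind_single)
    fix \<mu> assume "\<mu> \<in> set_pmf P"
    then have \<mu>: "\<mu> \<in> partitions_of n" using assms by (auto simp: random_partition_def)
    then have C: "?C \<mu> \<in> set_partitions_of_type {1..n} \<mu>"
      using color_partition_coloring[OF \<mu>] partition_on_color_classes[of "{1..n}" "coloring \<mu>"]
      by (auto simp: set_partitions_of_type_def color_partition_eq_block_sizes)
    have fin: "finite (set_partitions_of_type {1..n} \<mu>)"
      by (simp add: finite_set_partitions_of_type)
    have card: "card (set_partitions_of_type {1..n} \<mu>) = type_count \<mu>"
      using \<mu> by (intro card_set_partitions_of_type) (auto simp: partitions_of_def)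
    have iff: "S \<in> set_partitions_of_type {1..n} \<mu> \<longleftrightarrow> \<mu> = block_sizes S"
      using S by (auto simp: set_partitions_of_type_def)
    show "pmf (map_pmf (\<lambda>\<sigma>. (`) \<sigma> ` ?C \<mu>) (pmf_of_set {\<sigma>. \<sigma> permutes {1..n}})) S =
        (if \<mu> = block_sizes S then 1 / type_count (block_sizes S) else 0)"
      unfolding map_pmf_permutation_action[OF finite_atLeastAtMost C]
      using C card iff by (subst pmf_of_set[OF _ fin]) auto
  qed
  finally show ?thesis by simp
qed

section \<open>Deleting one ball or one color from a fixed coloring\<close>

context
  fixes n :: nat and \<mu> :: "nat multiset" and c :: "nat \<Rightarrow> nat"
  assumes c: "color_partition {1..n} c = \<mu>"
begin

lemma card_other_balls_of_color:
  assumes "b \<in> {1..n}"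
  shows "Suc (card {i \<in> {1..n} - {b}. c i = c b}) = card {i \<in> {1..n}. c i = c b}"
proof -
  have "{i \<in> {1..n}. c i = c b} = insert b {i \<in> {1..n} - {b}. c i = c b}" using assms by auto
  then show ?thesis by simp
qed

lemma color_partition_delete_color:
  assumes "b \<in> {1..n}"
  shows "add_mset (card {i \<in> {1..n}. c i = c b}) (color_partition {i \<in> {1..n}. c i \<noteq> c b} c) = \<mu>"
proof -
  have im: "c ` {1..n} = insert (c b) (c ` {i \<in> {1..n}. c i \<noteq> c b})"
    using assms by auto
  have "color_partition {i \<in> {1..n}. c i \<noteq> c b} c =
      image_mset (\<lambda>j. card {i \<in> {1..n}. c i = j}) (mset_set (c ` {i \<in> {1..n}. c i \<noteq> c b}))"
    unfolding color_partition_def by (intro image_mset_cong arg_cong[where f = card]) auto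
  moreover have "\<mu> = image_mset (\<lambda>j. card {i \<in> {1..n}. c i = j})
      (add_mset (c b) (mset_set (c ` {i \<in> {1..n}. c i \<noteq> c b})))"
    unfolding c[symmetric] color_partition_def im by (subst mset_set.insert) auto
  ultimately show ?thesis by simp
qed

text \<open>A color carried by a single ball disappears with that ball; any other color keeps its
  remaining \<open>k\<close> balls. Writing the result in terms of \<open>k\<close> and
  \<open>\<rho>\<close> lets sampling consistency be read off the joint law
  \<open>delete_color\<close>.\<close>

lemma color_partition_delete_ball:
  assumes "b \<in> {1..n}"
  defines "k \<equiv> card {i \<in> {1..n} - {b}. c i = c b}"
    and "\<rho> \<equiv> color_partition {i \<in> {1..n}. c i \<noteq> c b} c"
  shows "color_partition ({1..n} - {b}) c = (if k = 0 then \<rho> else add_mset k \<rho>)"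
proof (cases "k = 0")
  case True
  then have "{i \<in> {1..n} - {b}. c i = c b} = {}" by (simp add: k_def)
  then have "{i \<in> {1..n}. c i \<noteq> c b} = {1..n} - {b}" using assms(1) by auto
  then show ?thesis using True by (simp add: \<rho>_def)
next
  case False
  then have "{i \<in> {1..n} - {b}. c i = c b} \<noteq> {}" by (auto simp: k_def simp del: Diff_iff)
  then obtain i where "i \<in> {1..n} - {b}" "c i = c b" by blast
  then have "c b \<in> c ` ({1..n} - {b})" by (metis imageI)
  then have im: "c ` ({1..n} - {b}) = insert (c b) (c ` {i \<in> {1..n}. c i \<noteq> c b})" by auto
  have "color_partition ({1..n} - {b}) c =
      add_mset k (image_mset (\<lambda>j. card {i \<in> {1..n} - {b}. c i = j})
        (mset_set (c ` {i \<in> {1..n}. c i \<noteq> c b})))"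
    unfolding color_partition_def im k_def by (subst mset_set.insert) auto
  moreover have "image_mset (\<lambda>j. card {i \<in> {1..n} - {b}. c i = j})
        (mset_set (c ` {i \<in> {1..n}. c i \<noteq> c b})) = \<rho>"
    unfolding color_partition_def \<rho>_def by (intro image_mset_cong arg_cong[where f = card]) auto
  ultimately show ?thesis using False by simp
qed

lemma card_balls_in_classes_of_size:
  "card {b \<in> {1..n}. card {i \<in> {1..n}. c i = c b} = m} = m * count \<mu> m"
proof -
  let ?J = "{j \<in> c ` {1..n}. card {i \<in> {1..n}. c i = j} = m}"
  have "card {b \<in> {1..n}. card {i \<in> {1..n}. c i = c b} = m} = card (\<Union>j\<in>?J. {i \<in> {1..n}. c i = j})"
    by (rule arg_cong[where f = card]) auto
  also have "\<dots> = (\<Sum>j\<in>?J. card {i \<in> {1..n}. c i = j})"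
    by (rule card_UN_disjoint) auto
  also have "\<dots> = m * card ?J" by simp
  also have "card ?J = count \<mu> m"
    unfolding c[symmetric] color_partition_def by (simp add: count_image_mset' conj_commute eq_commute[of m])
  finally show ?thesis .
qed

end

text \<open>The outcome determines the partition before deletion. In it,
  \<open>Suc (count \<rho> (Suc k))\<close> classes have size \<open>Suc k\<close>, since
  \<open>k\<close> counts only the other balls of the chosen color; their balls are the favorable
  choices among \<open>n\<close>.\<close>

lemma pmf_delete_color:
  assumes "random_partition n P" "n \<ge> 1"
  shows "pmf (delete_color n P) (k, \<rho>) =
    pmf P (add_mset (Suc k) \<rho>) * (Suc k * Suc (count \<rho> (Suc k)) / n)"
  unfolding delete_color_def map_pmf_pair_pmf
proof (rule pmf_bind_single)
  fix \<mu> assume "\<mu> \<in> set_pmf P"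
  then have \<mu>: "\<mu> \<in> partitions_of n" using assms by (auto simp: random_partition_def)
  define c where "c = coloring \<mu>"
  have c: "color_partition {1..n} c = \<mu>" using color_partition_coloring[OF \<mu>] by (simp add: c_def)
  let ?F = "\<lambda>b. (card {i \<in> {1..n} - {b}. c i = c b}, color_partition {i \<in> {1..n}. c i \<noteq> c b} c)"
  have iff: "?F b = (k, \<rho>) \<longleftrightarrow> \<mu> = add_mset (Suc k) \<rho> \<and> card {i \<in> {1..n}. c i = c b} = Suc k"
    if "b \<in> {1..n}" for b
  proof -
    have "card {i \<in> {1..n}. c i = c b} = Suc k \<longleftrightarrow> card {i \<in> {1..n} - {b}. c i = c b} = k"
      using card_other_balls_of_color[OF c that] by linarith
    moreover have "\<mu> = add_mset (Suc k) \<rho> \<longleftrightarrow> color_partition {i \<in> {1..n}. c i \<noteq> c b} c = \<rho>"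
      if "card {i \<in> {1..n}. c i = c b} = Suc k"
      unfolding color_partition_delete_color[OF c \<open>b \<in> {1..n}\<close>, symmetric] that by simp
    ultimately show ?thesis by blast
  qed
  have "{1..n} \<inter> ?F -` {(k, \<rho>)} = {b \<in> {1..n}. ?F b = (k, \<rho>)}" by auto
  also have "\<dots> = (if \<mu> = add_mset (Suc k) \<rho>
      then {b \<in> {1..n}. card {i \<in> {1..n}. c i = c b} = Suc k} else {})"
    using iff by auto
  finally have "card ({1..n} \<inter> ?F -` {(k, \<rho>)}) =
      (if \<mu> = add_mset (Suc k) \<rho> then Suc k * Suc (count \<rho> (Suc k)) else 0)"
    using card_balls_in_classes_of_size[OF c, of "Suc k"] by auto
  then show "pmf (map_pmf (\<lambda>b. (card {i \<in> {1..n} - {b}. coloring \<mu> i = coloring \<mu> b},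
        color_partition {i \<in> {1..n}. coloring \<mu> i \<noteq> coloring \<mu> b} (coloring \<mu>)))
        (pmf_of_set {1..n})) (k, \<rho>) =
      (if \<mu> = add_mset (Suc k) \<rho> then Suc k * Suc (count \<rho> (Suc k)) / n else 0)"
    unfolding c_def[symmetric] pmf_map using assms(2) by (subst measure_pmf_of_set) auto
qed

lemma delete_ball_eq_map_delete_color:
  assumes "random_partition n P" "n \<ge> 1"
  shows "delete_ball n P =
    map_pmf (\<lambda>(k, \<rho>). if k = 0 then \<rho> else add_mset k \<rho>) (delete_color n P)"
  unfolding delete_ball_def delete_color_def map_pmf_comp
proof (rule map_pmf_cong[OF refl])
  fix x assume "x \<in> set_pmf (pair_pmf P (pmf_of_set {1..n}))"
  then obtain \<mu> b where x: "x = (\<mu>, b)" and "\<mu> \<in> set_pmf P" "b \<in> {1..n}"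
    using assms(2) by auto
  then have "\<mu> \<in> partitions_of n" using assms(1) by (auto simp: random_partition_def)
  then show "(case x of (\<mu>, b) \<Rightarrow> color_partition ({1..n} - {b}) (coloring \<mu>)) =
    (case (case x of (\<mu>, b) \<Rightarrow>
         (card {i \<in> {1..n} - {b}. coloring \<mu> i = coloring \<mu> b},
          color_partition {i \<in> {1..n}. coloring \<mu> i \<noteq> coloring \<mu> b} (coloring \<mu>)))
     of (k, \<rho>) \<Rightarrow> if k = 0 then \<rho> else add_mset k \<rho>)"
    unfolding x split_conv
    by (rule color_partition_delete_ball[OF color_partition_coloring \<open>b \<in> {1..n}\<close>])
qed

text \<open>Events are indexed by distinct block sizes, whereas the addition rule sums over blocks;
  multiplicities translate between the two.\<close>

lemma sum_mset_image_mset_count: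
  fixes g :: "'a \<Rightarrow> real"
  shows "(\<Sum>y\<in>#M. g y) = (\<Sum>y\<in>set_mset M. real (count M y) * g y)"
proof (induction M)
  case (add x M)
  have "(\<Sum>y\<in>set_mset (add_mset x M). real (count (add_mset x M) y) * g y) =
      (\<Sum>y\<in>insert x (set_mset M). real (count M y) * g y + (if y = x then g x else 0))"
    by (intro sum.cong) (auto simp: algebra_simps)
  also have "\<dots> = (\<Sum>y\<in>insert x (set_mset M). real (count M y) * g y) + g x"
    by (simp add: sum.distrib)
  also have "(\<Sum>y\<in>insert x (set_mset M). real (count M y) * g y) =
      (\<Sum>y\<in>set_mset M. real (count M y) * g y)"
    by (intro sum.mono_neutral_right) (auto simp: not_in_iff)
  finally show ?case using add by simp
qed simp

text \<open>The value of the EPPF at a composition with multiset of parts \<open>\<mu>\<close>.\<close>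
definition eppf :: "(nat \<Rightarrow> nat multiset pmf) \<Rightarrow> nat multiset \<Rightarrow> real" where
  "eppf \<pi> \<mu> = pmf (\<pi> (sum_mset \<mu>)) \<mu> / type_count \<mu>"

lemma eppf_nonneg: "eppf \<pi> \<mu> \<ge> 0"
  by (simp add: eppf_def)

lemma pmf_eq_type_count_mult_eppf:
  "0 \<notin># \<mu> \<Longrightarrow> pmf (\<pi> (sum_mset \<mu>)) \<mu> = type_count \<mu> * eppf \<pi> \<mu>"
  using type_count_pos[of \<mu>] by (simp add: eppf_def)

lemma composition_sum_list_pos: "composition l \<Longrightarrow> sum_list l \<ge> 1"
  by (cases l) (auto simp: composition_def)

text \<open>Every composition is the size sequence of some enumerated set partition because
  \<open>type_count\<close> is positive there, so the values of \<open>p\<close> at compositions are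
  exactly the probabilities of single set partitions.\<close>

lemma is_EPPF_iff:
  assumes "\<forall>n\<ge>1. random_partition n (\<pi> n)"
  shows "is_EPPF \<pi> p \<longleftrightarrow> (\<forall>l. composition l \<longrightarrow> p l = eppf \<pi> (mset l))"
proof
  assume p: "is_EPPF \<pi> p"
  show "\<forall>l. composition l \<longrightarrow> p l = eppf \<pi> (mset l)"
  proof (intro allI impI)
    fix l assume l: "composition l"
    define n where "n = sum_list l"
    have n: "n \<ge> 1" using composition_sum_list_pos[OF l] by (simp add: n_def)
    have "card (set_partitions_of_type {1..n} (mset l)) = type_count (mset l)"
      by (intro card_set_partitions_of_type) (auto simp: n_def sum_mset_sum_list)
    moreover have "type_count (mset l) > 0"
      using l by (intro type_count_pos) (auto simp: composition_def)
    ultimately obtain P where P: "P \<in> set_partitions_of_type {1..n} (mset l)"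
      by (metis card.empty ex_in_conv less_irrefl)
    then obtain Bs where Bs: "distinct Bs" "set Bs = P" "map card Bs = l"
      using enumerate_set_partition by blast
    have part: "partition_on {1..n} P" "block_sizes P = mset l"
      using P by (auto simp: set_partitions_of_type_def)
    have "p l = pmf (exchangeable_partition n (\<pi> n)) P"
      using p n Bs part unfolding is_EPPF_def by (metis (no_types, lifting))
    also have "\<dots> = eppf \<pi> (mset l)"
      using pmf_exchangeable_partition[OF assms[rule_format, OF n] part(1)] part(2)
      by (simp add: eppf_def n_def sum_mset_sum_list)
    finally show "p l = eppf \<pi> (mset l)" .
  qed
next
  assume p: "\<forall>l. composition l \<longrightarrow> p l = eppf \<pi> (mset l)"
  show "is_EPPF \<pi> p"
    unfolding is_EPPF_def
  proof (intro allI impI, elim conjE)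
    fix n :: nat and Bs assume n: "n \<ge> 1" and Bs: "distinct Bs" "partition_on {1..n} (set Bs)"
    have ms: "mset (map card Bs) = block_sizes (set Bs)"
      using mset_set_set[OF Bs(1)] by (simp add: block_sizes_def)
    have mem: "block_sizes (set Bs) \<in> partitions_of n" by (rule block_sizes_in_partitions_of[OF Bs(2)])
    have "Bs \<noteq> []" using Bs n by (auto simp: partition_on_def)
    moreover have "0 \<notin> set (map card Bs)"
      using mem ms by (metis (mono_tags, lifting) mem_Collect_eq partitions_of_def set_mset_mset)
    ultimately have "composition (map card Bs)" by (simp add: composition_def)
    then have "p (map card Bs) = eppf \<pi> (block_sizes (set Bs))" using p ms by metis
    also have "\<dots> = pmf (exchangeable_partition n (\<pi> n)) (set Bs)"
      using pmf_exchangeable_partition[OF assms[rule_format, OF n] Bs(2)] mem by (simp add: eppf_def partitions_of_def)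
    finally show "pmf (exchangeable_partition n (\<pi> n)) (set Bs) = p (map card Bs)" ..
  qed
qed

text \<open>By exchangeability the chosen ball may be regarded as fixed: the binomial coefficient
  selects its \<open>k\<close> companions among the other balls, and
  \<open>type_count \<rho>\<close> counts the partitions of the rest.\<close>

lemma pmf_delete_color_eppf:
  assumes "random_partition n (\<pi> n)" "n = Suc k + sum_mset \<rho>" "0 \<notin># \<rho>"
  shows "pmf (delete_color n (\<pi> n)) (k, \<rho>) =
    real (n - 1 choose k) * type_count \<rho> * eppf \<pi> (add_mset (Suc k) \<rho>)"
proof -
  have "pmf (delete_color n (\<pi> n)) (k, \<rho>) = eppf \<pi> (add_mset (Suc k) \<rho>) *
      (Suc k * (type_count (add_mset (Suc k) \<rho>) * Suc (count \<rho> (Suc k))) / n)"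
    using pmf_delete_color[OF assms(1), of k \<rho>]
      pmf_eq_type_count_mult_eppf[of "add_mset (Suc k) \<rho>" \<pi>] assms(2,3)
    by (simp add: mult_ac del: of_nat_Suc mult_Suc mult_Suc_right)
  also have "type_count (add_mset (Suc k) \<rho>) * Suc (count \<rho> (Suc k)) = (n choose Suc k) * type_count \<rho>"
    using type_count_add_mset[of "Suc k" \<rho>] assms(2) by simp
  also have "Suc k * ((n choose Suc k) * type_count \<rho>) = n * (n - 1 choose k) * type_count \<rho>"
  proof -
    have "Suc k * (n choose Suc k) = n * (n - 1 choose k)"
      using Suc_times_binomial[of k "n - 1"] assms(2) by simp
    then show ?thesis by (metis mult.assoc)
  qed
  finally have "pmf (delete_color n (\<pi> n)) (k, \<rho>) =
      eppf \<pi> (add_mset (Suc k) \<rho>) * (real (n * (n - 1 choose k) * type_count \<rho>) / n)" .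
  moreover have "n > 0" using assms(2) by simp
  ultimately show ?thesis by simp
qed

lemma type_count_remove:
  assumes "0 \<notin># \<nu>" "y \<in># \<nu>"
  shows "type_count \<nu> * count \<nu> y = (sum_mset \<nu> choose y) * type_count (\<nu> - {#y#})"
proof -
  have y: "y \<ge> 1" using assms by (cases y) auto
  have "add_mset y (\<nu> - {#y#}) = \<nu>" using assms by simp
  moreover have "y + sum_mset (\<nu> - {#y#}) = sum_mset \<nu>" "Suc (count (\<nu> - {#y#}) y) = count \<nu> y"
    using assms calculation by (metis sum_mset.add_mset, simp)
  ultimately show ?thesis using type_count_add_mset[OF y, of "\<nu> - {#y#}"] by simp
qed

text \<open>After the deletion of a ball the partition is \<open>\<nu>\<close> if the ball was alone
  or if its block shrank from \<open>Suc y\<close> to \<open>y\<close>. All these events carry the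
  common factor \<open>type_count \<nu>\<close>, which cancels.\<close>

lemma eppf_addition_rule:
  assumes "partition_structure \<pi>" "0 \<notin># \<nu>" "\<nu> \<noteq> {#}"
  shows "eppf \<pi> \<nu> = (\<Sum>y\<in>#\<nu>. eppf \<pi> (add_mset (Suc y) (\<nu> - {#y#}))) + eppf \<pi> (add_mset 1 \<nu>)"
proof -
  define n where "n = Suc (sum_mset \<nu>)"
  have "sum_mset \<nu> \<noteq> 0" using assms(2,3) by (metis multiset_nonemptyE sum_mset_0_iff)
  then have n: "n \<ge> 2" unfolding n_def by linarith
  have rp: "random_partition n (\<pi> n)" and del: "delete_ball n (\<pi> n) = \<pi> (sum_mset \<nu>)"
    using assms(1) n by (auto simp: partition_structure_def n_def)
  have D0: "pmf (delete_color n (\<pi> n)) (0, \<nu>) = type_count \<nu> * eppf \<pi> (add_mset 1 \<nu>)"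
    using pmf_delete_color_eppf[of n \<pi> 0 \<nu>, OF rp] assms(2) by (simp add: n_def)
  have Dy: "pmf (delete_color n (\<pi> n)) (y, \<nu> - {#y#}) =
      type_count \<nu> * (count \<nu> y * eppf \<pi> (add_mset (Suc y) (\<nu> - {#y#})))" if "y \<in># \<nu>" for y
  proof -
    have "n = Suc y + sum_mset (\<nu> - {#y#})"
      using sum_mset.remove[OF that] unfolding n_def by simp
    moreover have "0 \<notin># \<nu> - {#y#}" using assms(2) by (meson in_diffD)
    ultimately have "pmf (delete_color n (\<pi> n)) (y, \<nu> - {#y#}) =
        real ((n - 1 choose y) * type_count (\<nu> - {#y#})) * eppf \<pi> (add_mset (Suc y) (\<nu> - {#y#}))"
      using pmf_delete_color_eppf[of n \<pi> y "\<nu> - {#y#}", OF rp] by simp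
    also have "(n - 1 choose y) * type_count (\<nu> - {#y#}) = type_count \<nu> * count \<nu> y"
      using type_count_remove[OF assms(2) that] by (simp add: n_def)
    finally show ?thesis by simp
  qed
  \<comment> \<open>Since \<open>\<nu>\<close> has no part 0, the two kinds of preimages are
    disjoint.\<close>
  have vim: "(\<lambda>(k, \<rho>). if k = 0 then \<rho> else add_mset k \<rho>) -` {\<nu>} =
      insert (0, \<nu>) ((\<lambda>y. (y, \<nu> - {#y#})) ` set_mset \<nu>)" (is "?F -` _ = _")
  proof (intro set_eqI iffI)
    fix x assume "x \<in> insert (0, \<nu>) ((\<lambda>y. (y, \<nu> - {#y#})) ` set_mset \<nu>)"
    then show "x \<in> ?F -` {\<nu>}" using assms(2) by auto
  qed (auto split: if_splits simp: image_iff)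
  have "pmf (\<pi> (sum_mset \<nu>)) \<nu> = measure (measure_pmf (delete_color n (\<pi> n))) (?F -` {\<nu>})"
    using n by (simp add: del[symmetric] delete_ball_eq_map_delete_color[OF rp] pmf_map)
  also have "\<dots> = (\<Sum>x\<in>insert (0, \<nu>) ((\<lambda>y. (y, \<nu> - {#y#})) ` set_mset \<nu>). pmf (delete_color n (\<pi> n)) x)"
    unfolding vim by (rule measure_measure_pmf_finite) simp
  also have "\<dots> = pmf (delete_color n (\<pi> n)) (0, \<nu>) +
      (\<Sum>y\<in>set_mset \<nu>. pmf (delete_color n (\<pi> n)) (y, \<nu> - {#y#}))"
    using assms(2) by (subst sum.insert) (auto simp: sum.reindex inj_on_def)
  also have "(\<Sum>y\<in>set_mset \<nu>. pmf (delete_color n (\<pi> n)) (y, \<nu> - {#y#})) =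
      type_count \<nu> * (\<Sum>y\<in>#\<nu>. eppf \<pi> (add_mset (Suc y) (\<nu> - {#y#})))"
    unfolding sum_mset_image_mset_count sum_distrib_left by (intro sum.cong refl Dy)
  finally have "type_count \<nu> * eppf \<pi> \<nu> = type_count \<nu> *
      ((\<Sum>y\<in>#\<nu>. eppf \<pi> (add_mset (Suc y) (\<nu> - {#y#}))) + eppf \<pi> (add_mset 1 \<nu>))"
    by (simp add: D0 pmf_eq_type_count_mult_eppf[OF assms(2)] algebra_simps)
  then show ?thesis using type_count_pos[OF assms(2)] by simp
qed

section \<open>The color deletion property as a factorization\<close>

lemma finite_partitions_of: "finite (partitions_of n)"
proof (rule finite_subset)
  show "partitions_of n \<subseteq> block_sizes ` {P. partition_on {1..n} P}"
  proof
    fix \<mu> assume "\<mu> \<in> partitions_of n"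
    from color_partition_coloring[OF this] show "\<mu> \<in> block_sizes ` {P. partition_on {1..n} P}"
      using partition_on_color_classes[of "{1..n}" "coloring \<mu>"]
      unfolding color_partition_eq_block_sizes image_iff by (metis mem_Collect_eq)
  qed
  show "finite (block_sizes ` {P. partition_on {1..n} P})"
    by (intro finite_imageI finitely_many_partition_on) simp
qed

lemma partitions_of_nonempty: "\<rho> \<in> partitions_of r \<Longrightarrow> r \<ge> 1 \<Longrightarrow> \<rho> \<noteq> {#}"
  by (auto simp: partitions_of_def)

lemma sum_mset_pos:
  fixes \<rho> :: "nat multiset"
  assumes "0 \<notin># \<rho>" "\<rho> \<noteq> {#}"
  shows "sum_mset \<rho> \<ge> 1"
proof -
  have "sum_mset \<rho> \<noteq> 0" using assms by (metis multiset_nonemptyE sum_mset_0_iff)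
  then show ?thesis by linarith
qed

text \<open>Summing over all outcomes gives \<open>\<kappa> = 1\<close>. The sum is an integral in
  the extended nonnegative reals, which requires \<open>\<kappa> \<ge> 0\<close> first.\<close>

lemma pmf_proportional:
  assumes "\<And>x. pmf p x = \<kappa> * pmf q x"
  shows "p = q"
proof -
  obtain x where "x \<in> set_pmf p" using set_pmf_not_empty[of p] by blast
  then have "\<kappa> * pmf q x > 0" using pmf_positive assms by metis
  then have \<kappa>: "\<kappa> \<ge> 0" using pmf_nonneg[of q x] by (simp add: zero_less_mult_iff)
  have "1 = (\<integral>\<^sup>+x. ennreal (pmf p x) \<partial>count_space UNIV)" by (simp add: nn_integral_pmf_eq_1)
  also have "\<dots> = (\<integral>\<^sup>+x. ennreal \<kappa> * ennreal (pmf q x) \<partial>count_space UNIV)"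
    using \<kappa> by (simp add: assms ennreal_mult')
  also have "\<dots> = ennreal \<kappa>" by (simp add: nn_integral_cmult nn_integral_pmf_eq_1)
  finally have "\<kappa> = 1" by simp
  then show ?thesis using assms by (intro pmf_eqI) simp
qed

lemma pmf_map_snd_cond:
  assumes "set_pmf D \<inter> {x. fst x = k} \<noteq> {}"
  shows "pmf (map_pmf snd (cond_pmf D {x. fst x = k})) \<rho> =
    pmf D (k, \<rho>) / measure (measure_pmf D) {x. fst x = k}"
proof -
  let ?C = "cond_pmf D {x. fst x = k}"
  have "pmf (map_pmf snd ?C) \<rho> = measure (measure_pmf ?C) (snd -` {\<rho>} \<inter> set_pmf ?C)"
    by (simp add: pmf_map measure_Int_set_pmf)
  also have "snd -` {\<rho>} \<inter> set_pmf ?C = {(k, \<rho>)} \<inter> set_pmf ?C"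
    using assms by (auto simp: set_cond_pmf)
  also have "measure (measure_pmf ?C) \<dots> = pmf ?C (k, \<rho>)"
    by (simp only: measure_Int_set_pmf measure_pmf_single)
  finally show ?thesis using assms by (simp add: pmf_cond)
qed

text \<open>For fixed \<open>m\<close> and size of \<open>\<rho>\<close>, the normalizing
  probability and the binomial coefficient are constants that \<open>Z\<close> absorbs, and
  \<open>type_count \<rho>\<close> cancels. Conversely, a factorization makes the conditional law
  proportional to that of \<open>\<pi>'\<close>, and proportional laws coincide, so \<open>Z\<close>
  need not be identified.\<close>

lemma color_deletion_property_iff:
  assumes "partition_structure \<pi>"
  shows "color_deletion_property \<pi> \<pi>' \<longleftrightarrow> (\<forall>r\<ge>1. random_partition r (\<pi>' r)) \<and>
    (\<exists>Z. \<forall>m\<ge>1. \<forall>\<rho>. 0 \<notin># \<rho> \<longrightarrow> \<rho> \<noteq> {#} \<longrightarrow>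
      eppf \<pi> (add_mset m \<rho>) = Z m (sum_mset \<rho>) * eppf \<pi>' \<rho>)"
    (is "_ \<longleftrightarrow> ?R \<and> (\<exists>Z. ?P Z)")
proof
  have rp: "random_partition n (\<pi> n)" if "n \<ge> 1" for n
    using assms that by (simp add: partition_structure_def)
  let ?D = "\<lambda>n. delete_color n (\<pi> n)"
  have D: "pmf (?D (m + sum_mset \<rho>)) (m - 1, \<rho>) =
      real (m + sum_mset \<rho> - 1 choose (m - 1)) * type_count \<rho> * eppf \<pi> (add_mset m \<rho>)"
    if "m \<ge> 1" "0 \<notin># \<rho>" for m \<rho>
  proof -
    have "m + sum_mset \<rho> \<ge> 1" "m + sum_mset \<rho> = Suc (m - 1) + sum_mset \<rho>" "Suc (m - 1) = m"
      using that by simp_all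
    then show ?thesis using pmf_delete_color_eppf[of "m + sum_mset \<rho>" \<pi> "m - 1" \<rho>] rp[of "m + sum_mset \<rho>"] that(2) by metis
  qed
  {
    assume cdp: "color_deletion_property \<pi> \<pi>'"
    then have R: ?R by (simp add: color_deletion_property_def)
    define Z where "Z m r = measure (measure_pmf (?D (m + r))) {x. fst x = m - 1} /
      real (m + r - 1 choose (m - 1))" for m r
    have "?P Z"
    proof (intro allI impI)
      fix m and \<rho> :: "nat multiset" assume m: "(m :: nat) \<ge> 1" and \<rho>: "0 \<notin># \<rho>" "\<rho> \<noteq> {#}"
      let ?r = "sum_mset \<rho>"
      let ?A = "{x :: nat \<times> nat multiset. fst x = m - 1}"
      have r: "?r \<ge> 1" using sum_mset_pos[OF \<rho>] .
      have "pmf (?D (m + ?r)) (m - 1, \<rho>) = measure (measure_pmf (?D (m + ?r))) ?A * pmf (\<pi>' ?r) \<rho>"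
      \<comment> \<open>The deletion property says nothing about null events; there the
        factorization holds with \<open>Z m ?r = 0\<close>.\<close>
      proof (cases "set_pmf (?D (m + ?r)) \<inter> ?A = {}")
        case True
        then have "(m - 1, \<rho>) \<notin> set_pmf (?D (m + ?r))" by auto
        moreover have "measure (measure_pmf (?D (m + ?r))) ?A = 0"
          using True by (simp add: measure_pmf_zero_iff)
        ultimately show ?thesis by (simp add: pmf_eq_0_set_pmf)
      next
        case False
        have cond: "map_pmf snd (cond_pmf (?D n) {x. fst x = m - 1}) = \<pi>' (n - m)"
          if "1 \<le> m" "m < n" "set_pmf (?D n) \<inter> {x. fst x = m - 1} \<noteq> {}" for m n
          using cdp that unfolding color_deletion_property_def by blast
        have "map_pmf snd (cond_pmf (?D (m + ?r)) ?A) = \<pi>' ?r"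
          using cond[OF m _ False] r by simp
        then have "pmf (\<pi>' ?r) \<rho> = pmf (?D (m + ?r)) (m - 1, \<rho>) / measure (measure_pmf (?D (m + ?r))) ?A"
          using pmf_map_snd_cond[OF False] by metis
        moreover have "measure (measure_pmf (?D (m + ?r))) ?A \<noteq> 0"
          using False by (simp add: measure_pmf_zero_iff)
        ultimately show ?thesis by simp
      qed
      then have "type_count \<rho> * (real (m + ?r - 1 choose (m - 1)) * eppf \<pi> (add_mset m \<rho>)) =
          type_count \<rho> * (measure (measure_pmf (?D (m + ?r))) ?A * eppf \<pi>' \<rho>)"
        unfolding D[OF m \<rho>(1)] pmf_eq_type_count_mult_eppf[OF \<rho>(1)] by (simp add: mult_ac)
      then have "real (m + ?r - 1 choose (m - 1)) * eppf \<pi> (add_mset m \<rho>) =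
          measure (measure_pmf (?D (m + ?r))) ?A * eppf \<pi>' \<rho>"
        using type_count_pos[OF \<rho>(1)] by simp
      moreover have "real (m + ?r - 1 choose (m - 1)) > 0" by simp
      ultimately show "eppf \<pi> (add_mset m \<rho>) = Z m ?r * eppf \<pi>' \<rho>"
        unfolding Z_def by (simp add: field_simps)
    qed
    then show "?R \<and> (\<exists>Z. ?P Z)" using R by blast
  }
  assume "?R \<and> (\<exists>Z. ?P Z)"
  then obtain Z where R: ?R and Z: "?P Z" by blast
  show "color_deletion_property \<pi> \<pi>'"
    unfolding color_deletion_property_def
  proof (intro conjI allI impI)
    show "r \<ge> 1 \<Longrightarrow> random_partition r (\<pi>' r)" for r using R by simp
    fix m n assume "1 \<le> m \<and> m < n \<and> set_pmf (?D n) \<inter> {x. fst x = m - 1} \<noteq> {}"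
    then have m: "1 \<le> m" "m < n" and ne: "set_pmf (?D n) \<inter> {x. fst x = m - 1} \<noteq> {}" by auto
    let ?A = "{x :: nat \<times> nat multiset. fst x = m - 1}"
    define \<kappa> where "\<kappa> = real (n - 1 choose (m - 1)) * Z m (n - m) / measure (measure_pmf (?D n)) ?A"
    show "map_pmf snd (cond_pmf (?D n) ?A) = \<pi>' (n - m)"
    proof (rule pmf_proportional)
      fix \<rho>
      show "pmf (map_pmf snd (cond_pmf (?D n) ?A)) \<rho> = \<kappa> * pmf (\<pi>' (n - m)) \<rho>"
      proof (cases "\<rho> \<in> partitions_of (n - m)")
        case True
        then have \<rho>: "0 \<notin># \<rho>" "\<rho> \<noteq> {#}" and r: "sum_mset \<rho> = n - m"
          using m by (auto simp: partitions_of_def)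
        have "pmf (?D n) (m - 1, \<rho>) =
            real (n - 1 choose (m - 1)) * type_count \<rho> * eppf \<pi> (add_mset m \<rho>)"
          using D[OF m(1) \<rho>(1)] m by (simp add: r)
        also have "eppf \<pi> (add_mset m \<rho>) = Z m (n - m) * eppf \<pi>' \<rho>"
          using Z m \<rho> by (metis r)
        finally show ?thesis
          unfolding pmf_map_snd_cond[OF ne] \<kappa>_def
          using pmf_eq_type_count_mult_eppf[OF \<rho>(1), of \<pi>'] by (simp add: r)
      next
        case False
        have "n - m \<ge> 1" using m by simp
        then have "pmf (\<pi>' (n - m)) \<rho> = 0"
          using False R by (auto simp: pmf_eq_0_set_pmf random_partition_def)
        moreover have "add_mset m \<rho> \<notin> partitions_of n"
          using False m by (auto simp: partitions_of_def)
        then have "pmf (\<pi> n) (add_mset m \<rho>) = 0"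
          using rp[of n] m by (auto simp: pmf_eq_0_set_pmf random_partition_def)
        then have "pmf (?D n) (m - 1, \<rho>) = 0"
          using pmf_delete_color[OF rp, of n "m - 1" \<rho>] m by simp
        ultimately show ?thesis unfolding pmf_map_snd_cond[OF ne] by simp
      qed
    qed
  qed
qed

section \<open>Total mass of functions satisfying the addition rule\<close>

lemma sum_partitions_remove_part:
  fixes F :: "nat \<Rightarrow> nat multiset \<Rightarrow> real"
  shows "(\<Sum>\<mu>\<in>partitions_of n. \<Sum>k\<in>set_mset \<mu>. F k (\<mu> - {#k#})) =
    (\<Sum>k=1..n. \<Sum>\<rho>\<in>partitions_of (n - k). F k \<rho>)"
proof -
  have "(\<Sum>\<mu>\<in>partitions_of n. \<Sum>k\<in>set_mset \<mu>. F k (\<mu> - {#k#})) =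
      (\<Sum>(\<mu>, k)\<in>Sigma (partitions_of n) set_mset. F k (\<mu> - {#k#}))"
    by (rule sum.Sigma) (auto simp: finite_partitions_of)
  also have "\<dots> = (\<Sum>(k, \<rho>)\<in>(SIGMA k:{1..n}. partitions_of (n - k)). F k \<rho>)"
  proof (rule sum.reindex_bij_witness[where j = "\<lambda>(\<mu>, k). (k, \<mu> - {#k#})" and i = "\<lambda>(k, \<rho>). (add_mset k \<rho>, k)"], goal_cases)
    case (2 x)
    then obtain \<mu> k where x: "x = (\<mu>, k)" "0 \<notin># \<mu>" "sum_mset \<mu> = n" "k \<in># \<mu>"
      by (auto simp: partitions_of_def)
    have s: "n = k + sum_mset (\<mu> - {#k#})" using sum_mset.remove[OF x(4)] x(3) by simp
    have "k \<ge> 1" using x by (cases k) auto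
    moreover have "0 \<notin># \<mu> - {#k#}" using x(2) by (meson in_diffD)
    ultimately show ?case using s x(1) by (auto simp: partitions_of_def)
  qed (auto simp: partitions_of_def)
  also have "\<dots> = (\<Sum>k=1..n. \<Sum>\<rho>\<in>partitions_of (n - k). F k \<rho>)"
    by (rule sum.Sigma[symmetric]) (auto simp: finite_partitions_of)
  finally show ?thesis .
qed

text \<open>The mass of all set partitions of n + 1 elements is grouped according to the partition
  that remains when one fixed element is deleted. By the addition rule each group has the mass of
  that smaller partition, so the total does not depend on n.\<close>

lemma total_mass_of_addition_rule:
  fixes h :: "nat multiset \<Rightarrow> real"
  assumes add: "\<And>\<nu>. 0 \<notin># \<nu> \<Longrightarrow> \<nu> \<noteq> {#} \<Longrightarrow>
      h \<nu> = (\<Sum>y\<in>#\<nu>. h (add_mset (Suc y) (\<nu> - {#y#}))) + h (add_mset 1 \<nu>)"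
    and "n \<ge> 1"
  shows "(\<Sum>\<mu>\<in>partitions_of n. type_count \<mu> * h \<mu>) = h {#1#}"
  using \<open>n \<ge> 1\<close>
proof (induction n rule: nat_induct_at_least)
  case base
  have "\<mu> = {#1#}" if \<mu>: "\<mu> \<in> partitions_of 1" for \<mu>
  proof -
    obtain x \<rho> where x: "\<mu> = add_mset x \<rho>"
      using partitions_of_nonempty[OF \<mu>] by (metis le_refl multiset_cases)
    then have "x \<noteq> 0" "0 \<notin># \<rho>" "x + sum_mset \<rho> = 1" using \<mu> by (auto simp: partitions_of_def)
    moreover from this have "sum_mset \<rho> = 0" by linarith
    ultimately show ?thesis using sum_mset_pos[of \<rho>] x by (cases "\<rho> = {#}") auto
  qed
  then have "partitions_of 1 = {{#1#}}" by (auto simp: partitions_of_def)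
  moreover have "type_count {#1#} = 1"
    using type_count_add_mset[of 1 "{#}"] by (simp add: type_count_empty)
  ultimately show ?case by simp
next
  case (Suc n)
  \<comment> \<open>\<open>F k \<rho>\<close> is the mass of the set partitions of n + 1 elements in
    which a fixed element has a block of size \<open>k\<close> and the other blocks have type
    \<open>\<rho>\<close>.\<close>
  define F where "F k \<rho> = real (n choose (k - 1)) * type_count \<rho> * h (add_mset k \<rho>)" for k \<rho>
  have "(\<Sum>\<mu>\<in>partitions_of (Suc n). type_count \<mu> * h \<mu>) =
      (\<Sum>\<mu>\<in>partitions_of (Suc n). \<Sum>k\<in>set_mset \<mu>. F k (\<mu> - {#k#}))"
  proof (rule sum.cong[OF refl])
    fix \<mu> assume "\<mu> \<in> partitions_of (Suc n)"
    then have \<mu>: "0 \<notin># \<mu>" "sum_mset \<mu> = Suc n" by (auto simp: partitions_of_def)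
    \<comment> \<open>By symmetry the fixed element lies in a block of size \<open>k\<close> for a
      fraction \<open>count \<mu> k * k / Suc n\<close> of the partitions of type
      \<open>\<mu>\<close>. These fractions add up to 1.\<close>
    have F: "Suc n * F k (\<mu> - {#k#}) = real (count \<mu> k * k) * (type_count \<mu> * h \<mu>)" if k: "k \<in># \<mu>" for k
    proof -
      obtain j where j: "k = Suc j" using \<mu> k by (cases k) auto
      have "Suc n * (n choose j) * type_count (\<mu> - {#k#}) = k * ((Suc n choose k) * type_count (\<mu> - {#k#}))"
        using Suc_times_binomial[of j n] unfolding j by (metis mult.assoc)
      also have "\<dots> = k * (type_count \<mu> * count \<mu> k)"
        using type_count_remove[OF \<mu>(1) k] \<mu>(2) by simp
      finally have "real (Suc n * (n choose j) * type_count (\<mu> - {#k#})) = real (k * (type_count \<mu> * count \<mu> k))"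
        by simp
      then have "real (Suc n) * (real (n choose j) * type_count (\<mu> - {#k#})) =
          real (count \<mu> k * k) * type_count \<mu>"
        by (simp only: of_nat_mult mult_ac)
      moreover have "add_mset k (\<mu> - {#k#}) = \<mu>" using k by simp
      moreover have "k - 1 = j" using j by simp
      ultimately show ?thesis unfolding F_def by (metis mult.assoc)
    qed
    have "Suc n * (\<Sum>k\<in>set_mset \<mu>. F k (\<mu> - {#k#})) =
        (\<Sum>k\<in>set_mset \<mu>. real (count \<mu> k) * real k) * (type_count \<mu> * h \<mu>)"
      unfolding sum_distrib_left sum_distrib_right by (rule sum.cong) (simp_all add: F del: of_nat_Suc)
    also have "(\<Sum>k\<in>set_mset \<mu>. real (count \<mu> k) * real k) = Suc n"
      unfolding sum_mset_image_mset_count[symmetric] using \<mu>(2) by (metis of_nat_sum_mset)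
    finally show "type_count \<mu> * h \<mu> = (\<Sum>k\<in>set_mset \<mu>. F k (\<mu> - {#k#}))" by simp
  qed
  also have "\<dots> = (\<Sum>k=1..Suc n. \<Sum>\<rho>\<in>partitions_of (Suc n - k). F k \<rho>)"
    by (rule sum_partitions_remove_part)
  \<comment> \<open>The case in which the fixed element is a singleton is split off; elsewhere its
    deletion leaves a block of size \<open>k\<close>.\<close>
  also have "\<dots> = (\<Sum>\<rho>\<in>partitions_of n. F 1 \<rho>) + (\<Sum>k=1..n. \<Sum>\<rho>\<in>partitions_of (n - k). F (Suc k) \<rho>)"
    unfolding One_nat_def
    by (subst sum.atLeast_Suc_atMost) (simp_all only: sum.shift_bounds_cl_Suc_ivl diff_Suc_Suc diff_zero le_add1 plus_1_eq_Suc)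
  also have "\<dots> = (\<Sum>\<nu>\<in>partitions_of n. F 1 \<nu>) +
      (\<Sum>\<nu>\<in>partitions_of n. \<Sum>y\<in>set_mset \<nu>. F (Suc y) (\<nu> - {#y#}))"
    using sum_partitions_remove_part[of "\<lambda>k. F (Suc k)" n] by simp
  also have "\<dots> = (\<Sum>\<nu>\<in>partitions_of n. type_count \<nu> * h \<nu>)"
    unfolding sum.distrib[symmetric]
  proof (rule sum.cong[OF refl])
    fix \<nu> assume "\<nu> \<in> partitions_of n"
    then have \<nu>: "0 \<notin># \<nu>" "sum_mset \<nu> = n" "\<nu> \<noteq> {#}"
      using \<open>n \<ge> 1\<close> partitions_of_nonempty by (auto simp: partitions_of_def)
    have "F (Suc y) (\<nu> - {#y#}) = type_count \<nu> * (count \<nu> y * h (add_mset (Suc y) (\<nu> - {#y#})))"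
      if "y \<in># \<nu>" for y
    proof -
      have "F (Suc y) (\<nu> - {#y#}) =
          real ((n choose y) * type_count (\<nu> - {#y#})) * h (add_mset (Suc y) (\<nu> - {#y#}))"
        by (simp add: F_def)
      then show ?thesis using type_count_remove[OF \<nu>(1) that] \<nu>(2) by (simp flip: of_nat_mult)
    qed
    then have "(\<Sum>y\<in>set_mset \<nu>. F (Suc y) (\<nu> - {#y#})) =
        type_count \<nu> * (\<Sum>y\<in>#\<nu>. h (add_mset (Suc y) (\<nu> - {#y#})))"
      unfolding sum_mset_image_mset_count sum_distrib_left by (rule sum.cong[OF refl])
    moreover have "F 1 \<nu> = type_count \<nu> * h (add_mset 1 \<nu>)" by (simp add: F_def)
    ultimately show "F 1 \<nu> + (\<Sum>y\<in>set_mset \<nu>. F (Suc y) (\<nu> - {#y#})) = type_count \<nu> * h \<nu>"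
      using add[OF \<nu>(1,3)] by (simp add: algebra_simps)
  qed
  finally show ?case using Suc by simp
qed

lemma total_mass_eppf:
  assumes "random_partition r (\<pi> r)"
  shows "(\<Sum>\<mu>\<in>partitions_of r. type_count \<mu> * eppf \<pi> \<mu>) = 1"
proof -
  have "(\<Sum>\<mu>\<in>partitions_of r. type_count \<mu> * eppf \<pi> \<mu>) = (\<Sum>\<mu>\<in>partitions_of r. pmf (\<pi> r) \<mu>)"
    using pmf_eq_type_count_mult_eppf[of _ \<pi>] by (intro sum.cong) (auto simp: partitions_of_def)
  then show ?thesis
    using assms sum_pmf_eq_1[OF finite_partitions_of] by (simp add: random_partition_def)
qed

lemma random_partition_of_eppf:
  fixes h :: "nat multiset \<Rightarrow> real"
  assumes nonneg: "\<And>\<mu>. \<mu> \<in> partitions_of r \<Longrightarrow> h \<mu> \<ge> 0"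
    and sum: "(\<Sum>\<mu>\<in>partitions_of r. type_count \<mu> * h \<mu>) = 1"
  shows "\<exists>q. random_partition r q \<and> (\<forall>\<mu>\<in>partitions_of r. pmf q \<mu> = type_count \<mu> * h \<mu>)"
proof -
  define w where "w \<mu> = (if \<mu> \<in> partitions_of r then type_count \<mu> * h \<mu> else 0)" for \<mu>
  have w: "w \<mu> \<ge> 0" for \<mu> using nonneg by (simp add: w_def)
  have "(\<integral>\<^sup>+\<mu>. ennreal (w \<mu>) \<partial>count_space UNIV) = (\<Sum>\<mu>\<in>partitions_of r. ennreal (w \<mu>))"
    using finite_partitions_of by (intro nn_integral_count_space'[of "partitions_of r"]) (auto simp: w_def)
  also have "\<dots> = ennreal (\<Sum>\<mu>\<in>partitions_of r. w \<mu>)" using w by (simp add: sum_ennreal)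
  also have "(\<Sum>\<mu>\<in>partitions_of r. w \<mu>) = 1" using sum by (simp add: w_def)
  finally have "(\<integral>\<^sup>+\<mu>. ennreal (w \<mu>) \<partial>count_space UNIV) = 1" by simp
  from pmf_embed_pmf[OF w this] have "pmf (embed_pmf w) \<mu> = w \<mu>" for \<mu> .
  then show ?thesis
    by (intro exI[of _ "embed_pmf w"]) (auto simp: random_partition_def set_pmf_iff w_def split: if_splits)
qed

text \<open>The addition rule normalizes \<open>h\<close> at every size, and
  \<open>Z 1 r > 0\<close> transfers nonnegativity from the EPPF, so \<open>h\<close> is the EPPF of
  random partitions. For uniqueness, two factorizations compared at \<open>m = 1\<close> are
  proportional, and equal total mass makes them equal.\<close>

lemma color_deletion_of_product_form:
  fixes h :: "nat multiset \<Rightarrow> real" and Z :: "nat \<Rightarrow> nat \<Rightarrow> real"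
  assumes ps: "partition_structure \<pi>"
    and prod: "\<And>m \<rho>. m \<ge> 1 \<Longrightarrow> 0 \<notin># \<rho> \<Longrightarrow> \<rho> \<noteq> {#} \<Longrightarrow>
      eppf \<pi> (add_mset m \<rho>) = Z m (sum_mset \<rho>) * h \<rho>"
    and Z: "\<And>r. r \<ge> 1 \<Longrightarrow> Z 1 r > 0"
    and add: "\<And>\<nu>. 0 \<notin># \<nu> \<Longrightarrow> \<nu> \<noteq> {#} \<Longrightarrow>
      h \<nu> = (\<Sum>y\<in>#\<nu>. h (add_mset (Suc y) (\<nu> - {#y#}))) + h (add_mset 1 \<nu>)"
    and one: "h {#1#} = 1"
  shows "\<exists>\<pi>'. color_deletion_property \<pi> \<pi>'"
    and "color_deletion_property \<pi> \<pi>' \<Longrightarrow> 0 \<notin># \<rho> \<Longrightarrow> \<rho> \<noteq> {#} \<Longrightarrow> eppf \<pi>' \<rho> = h \<rho>"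
proof -
  have sum: "(\<Sum>\<mu>\<in>partitions_of r. type_count \<mu> * h \<mu>) = 1" if "r \<ge> 1" for r
    using total_mass_of_addition_rule[OF add that] one by simp
  have mem: "0 \<notin># \<mu> \<and> \<mu> \<noteq> {#} \<and> sum_mset \<mu> = r" if "\<mu> \<in> partitions_of r" "r \<ge> 1" for \<mu> r
    using that by (auto simp: partitions_of_def)
  have nonneg: "h \<mu> \<ge> 0" if "\<mu> \<in> partitions_of r" "r \<ge> 1" for \<mu> r
    using prod[of 1 \<mu>] mem[OF that] Z[OF that(2)] eppf_nonneg[of \<pi> "add_mset 1 \<mu>"]
    by (simp add: zero_le_mult_iff)
  show "\<exists>\<pi>'. color_deletion_property \<pi> \<pi>'"
  proof -
    have "\<forall>r. \<exists>q. r \<ge> 1 \<longrightarrow> random_partition r q \<and> (\<forall>\<mu>\<in>partitions_of r. pmf q \<mu> = type_count \<mu> * h \<mu>)"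
      using random_partition_of_eppf nonneg sum by meson
    then obtain \<pi>' where \<pi>': "r \<ge> 1 \<Longrightarrow> random_partition r (\<pi>' r)"
      "r \<ge> 1 \<Longrightarrow> \<mu> \<in> partitions_of r \<Longrightarrow> pmf (\<pi>' r) \<mu> = type_count \<mu> * h \<mu>" for r \<mu>
      by metis
    have "eppf \<pi>' \<rho> = h \<rho>" if \<rho>: "0 \<notin># \<rho>" "\<rho> \<noteq> {#}" for \<rho>
      using \<pi>'(2)[of "sum_mset \<rho>" \<rho>] sum_mset_pos[OF \<rho>] type_count_pos[OF \<rho>(1)] \<rho>(1)
      by (simp add: eppf_def partitions_of_def)
    then have "color_deletion_property \<pi> \<pi>'"
      unfolding color_deletion_property_iff[OF ps] using \<pi>'(1) prod by (intro conjI exI[of _ Z]) auto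
    then show ?thesis by blast
  qed
  assume "color_deletion_property \<pi> \<pi>'" and \<rho>: "0 \<notin># \<rho>" "\<rho> \<noteq> {#}"
  then obtain Y where rp: "\<And>r. r \<ge> 1 \<Longrightarrow> random_partition r (\<pi>' r)"
    and Y: "\<And>m \<rho>. m \<ge> 1 \<Longrightarrow> 0 \<notin># \<rho> \<Longrightarrow> \<rho> \<noteq> {#} \<Longrightarrow>
      eppf \<pi> (add_mset m \<rho>) = Y m (sum_mset \<rho>) * eppf \<pi>' \<rho>"
    unfolding color_deletion_property_iff[OF ps] by metis
  define r where "r = sum_mset \<rho>"
  have r: "r \<ge> 1" using sum_mset_pos[OF \<rho>] by (simp add: r_def)
  have eq: "Z 1 r * h \<mu> = Y 1 r * eppf \<pi>' \<mu>" if "\<mu> \<in> partitions_of r" for \<mu>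
    using prod[of 1 \<mu>] Y[of 1 \<mu>] mem[OF that r] by simp
  have "Z 1 r * (\<Sum>\<mu>\<in>partitions_of r. type_count \<mu> * h \<mu>) =
      Y 1 r * (\<Sum>\<mu>\<in>partitions_of r. type_count \<mu> * eppf \<pi>' \<mu>)"
    unfolding sum_distrib_left by (intro sum.cong refl) (use eq in \<open>simp add: mult.left_commute\<close>)
  then have "Z 1 r = Y 1 r" using sum[OF r] total_mass_eppf[of r \<pi>', OF rp[OF r]] by simp
  then show "eppf \<pi>' \<rho> = h \<rho>" using eq[of \<rho>] \<rho>(1) Z[OF r] by (simp add: r_def partitions_of_def)
qed

section \<open>The extended two-parameter family\<close>

definition two_parameter_weight :: "real \<Rightarrow> real \<Rightarrow> nat multiset \<Rightarrow> real" where
  "two_parameter_weight \<alpha> \<theta> \<mu> =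
     (\<Prod>i = 1..<size \<mu>. \<theta> + real i * \<alpha>) / pochhammer (\<theta> + 1) (sum_mset \<mu> - 1)
       * (\<Prod>x\<in>#\<mu>. pochhammer (1 - \<alpha>) (x - 1))"

definition coupon_weight :: "nat \<Rightarrow> nat multiset \<Rightarrow> real" where
  "coupon_weight M \<mu> = (\<Prod>i<size \<mu>. real M - real i) / real M ^ sum_mset \<mu>"

lemma two_parameter_EPPF_eq_weight: "two_parameter_EPPF \<alpha> \<theta> l = two_parameter_weight \<alpha> \<theta> (mset l)"
  by (simp add: two_parameter_EPPF_def two_parameter_weight_def sum_mset_sum_list prod_mset_prod_list
      flip: mset_map)

lemma coupon_EPPF_eq_weight: "coupon_EPPF M l = coupon_weight M (mset l)"
  by (simp add: coupon_EPPF_def coupon_weight_def sum_mset_sum_list)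

section \<open>Prediction rules, addition rules and factorizations of the weights\<close>

lemma two_parameter_weight_singleton_1: "two_parameter_weight \<alpha> \<theta> {#1#} = 1"
  by (simp add: two_parameter_weight_def)

text \<open>The seating rule of the Chinese restaurant process for an occupied table. It holds for
  every \<theta>, because division by zero yields 0 on both sides.\<close>

lemma two_parameter_weight_Suc:
  assumes "a \<ge> 1"
  shows "two_parameter_weight \<alpha> \<theta> (add_mset (Suc a) \<rho>) =
    (real a - \<alpha>) / (real (a + sum_mset \<rho>) + \<theta>) * two_parameter_weight \<alpha> \<theta> (add_mset a \<rho>)"
proof -
  obtain b where b: "a = Suc b" using assms by (cases a) auto
  define C where "C = (\<Prod>i = 1..<Suc (size \<rho>). \<theta> + real i * \<alpha>)"
  define R where "R = (\<Prod>x\<in>#\<rho>. pochhammer (1 - \<alpha>) (x - 1))"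
  have w: "two_parameter_weight \<alpha> \<theta> (add_mset (Suc c) \<rho>) =
      C / pochhammer (\<theta> + 1) (c + sum_mset \<rho>) * (pochhammer (1 - \<alpha>) c * R)" for c
    by (simp add: two_parameter_weight_def C_def R_def)
  have "pochhammer (\<theta> + 1) (Suc b + sum_mset \<rho>) =
      pochhammer (\<theta> + 1) (b + sum_mset \<rho>) * (real (a + sum_mset \<rho>) + \<theta>)"
    by (simp add: pochhammer_Suc b add_ac)
  moreover have "pochhammer (1 - \<alpha>) (Suc b) = pochhammer (1 - \<alpha>) b * (real a - \<alpha>)"
    by (simp add: pochhammer_Suc b add_ac)
  ultimately show ?thesis unfolding b w by (simp add: mult_ac)
qed

lemma two_parameter_weight_add_1:
  assumes "0 \<notin># \<mu>" "\<mu> \<noteq> {#}"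
  shows "two_parameter_weight \<alpha> \<theta> (add_mset 1 \<mu>) =
    (\<theta> + real (size \<mu>) * \<alpha>) / (real (sum_mset \<mu>) + \<theta>) * two_parameter_weight \<alpha> \<theta> \<mu>"
proof -
  obtain b where b: "sum_mset \<mu> = Suc b" using sum_mset_pos[OF assms] by (cases "sum_mset \<mu>") auto
  have "size \<mu> \<ge> 1" using assms(2) by (simp add: Suc_le_eq nonempty_has_size)
  then have "(\<Prod>i = 1..<Suc (size \<mu>). \<theta> + real i * \<alpha>) =
      (\<Prod>i = 1..<size \<mu>. \<theta> + real i * \<alpha>) * (\<theta> + real (size \<mu>) * \<alpha>)"
    by (rule prod.atLeastLessThan_Suc)
  then show ?thesis
    by (simp add: two_parameter_weight_def b pochhammer_Suc add_ac mult_ac)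
qed

lemma coupon_weight_singleton_1: "M \<ge> 1 \<Longrightarrow> coupon_weight M {#1#} = 1"
  by (simp add: coupon_weight_def)

lemma coupon_weight_Suc:
  "coupon_weight M (add_mset (Suc a) \<rho>) = 1 / real M * coupon_weight M (add_mset a \<rho>)"
  by (simp add: coupon_weight_def)

lemma coupon_weight_add_1:
  "M \<ge> 1 \<Longrightarrow> coupon_weight M (add_mset 1 \<mu>) = (1 - real (size \<mu>) * (1 / real M)) * coupon_weight M \<mu>"
  by (simp add: coupon_weight_def field_simps)

lemma sum_mset_linear:
  fixes s d :: real
  shows "(\<Sum>y\<in>#\<mu>. s + d * real y) = s * size \<mu> + d * real (sum_mset \<mu>)"
  by (induction \<mu>) (simp_all add: algebra_simps)

text \<open>Transition probabilities linear in the block size sum to an expression in the number of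
  blocks and of balls only; opening a new block takes the complementary probability.\<close>

lemma addition_rule_of_prediction_rule:
  fixes h :: "nat multiset \<Rightarrow> real"
  assumes "\<And>y. y \<in># \<nu> \<Longrightarrow> h (add_mset (Suc y) (\<nu> - {#y#})) = (s + d * real y) * h \<nu>"
    and "h (add_mset 1 \<nu>) = (1 - s * size \<nu> - d * real (sum_mset \<nu>)) * h \<nu>"
  shows "h \<nu> = (\<Sum>y\<in>#\<nu>. h (add_mset (Suc y) (\<nu> - {#y#}))) + h (add_mset 1 \<nu>)"
proof -
  have "(\<Sum>y\<in>#\<nu>. h (add_mset (Suc y) (\<nu> - {#y#}))) = (\<Sum>y\<in>#\<nu>. (s + d * real y) * h \<nu>)"
    using assms(1) by (intro arg_cong[where f = sum_mset] image_mset_cong) auto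
  also have "\<dots> = (\<Sum>y\<in>#\<nu>. s + d * real y) * h \<nu>"
    by (simp add: sum_mset_distrib_right)
  finally show ?thesis using assms(2) by (simp add: sum_mset_linear algebra_simps)
qed

lemma two_parameter_weight_addition_rule:
  assumes "\<theta> > -1" "0 \<notin># \<nu>" "\<nu> \<noteq> {#}"
  shows "two_parameter_weight \<alpha> \<theta> \<nu> =
    (\<Sum>y\<in>#\<nu>. two_parameter_weight \<alpha> \<theta> (add_mset (Suc y) (\<nu> - {#y#}))) +
    two_parameter_weight \<alpha> \<theta> (add_mset 1 \<nu>)"
proof (rule addition_rule_of_prediction_rule)
  let ?n = "real (sum_mset \<nu>)"
  have "?n \<ge> 1" using of_nat_mono[OF sum_mset_pos[OF assms(2,3)], where 'a = real] by simp
  then have pos: "?n + \<theta> > 0" using assms(1) by linarith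
  show "two_parameter_weight \<alpha> \<theta> (add_mset (Suc y) (\<nu> - {#y#})) =
      (- \<alpha> / (?n + \<theta>) + 1 / (?n + \<theta>) * real y) * two_parameter_weight \<alpha> \<theta> \<nu>"
    if y: "y \<in># \<nu>" for y
  proof -
    have "y \<ge> 1" using y assms(2) by (cases y) auto
    moreover have "add_mset y (\<nu> - {#y#}) = \<nu>" using y by simp
    moreover have "y + sum_mset (\<nu> - {#y#}) = sum_mset \<nu>" using sum_mset.remove[OF y] by simp
    ultimately show ?thesis using two_parameter_weight_Suc[of y \<alpha> \<theta> "\<nu> - {#y#}"]
      by (simp add: diff_divide_distrib)
  qed
  have "(\<theta> + real (size \<nu>) * \<alpha>) / (?n + \<theta>) =
      1 - - \<alpha> / (?n + \<theta>) * real (size \<nu>) - 1 / (?n + \<theta>) * ?n"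
  proof -
    have "(\<theta> + k * \<alpha>) / D = 1 - - \<alpha> / D * k - 1 / D * (D - \<theta>)" if "D > 0" for k D
      using that by (simp add: field_simps)
    from this[OF pos] show ?thesis by simp
  qed
  then show "two_parameter_weight \<alpha> \<theta> (add_mset 1 \<nu>) =
      (1 - - \<alpha> / (?n + \<theta>) * real (size \<nu>) - 1 / (?n + \<theta>) * ?n) * two_parameter_weight \<alpha> \<theta> \<nu>"
    using two_parameter_weight_add_1[OF assms(2,3)] by metis
qed

lemma coupon_weight_addition_rule:
  assumes "M \<ge> 1"
  shows "coupon_weight M \<nu> =
    (\<Sum>y\<in>#\<nu>. coupon_weight M (add_mset (Suc y) (\<nu> - {#y#}))) + coupon_weight M (add_mset 1 \<nu>)"
proof (rule addition_rule_of_prediction_rule[where s = "1 / real M" and d = 0])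
  show "coupon_weight M (add_mset (Suc y) (\<nu> - {#y#})) = (1 / real M + 0 * real y) * coupon_weight M \<nu>"
    if "y \<in># \<nu>" for y
    using that coupon_weight_Suc[of M y "\<nu> - {#y#}"] by simp
  show "coupon_weight M (add_mset 1 \<nu>) =
      (1 - 1 / real M * real (size \<nu>) - 0 * real (sum_mset \<nu>)) * coupon_weight M \<nu>"
    by (simp only: coupon_weight_add_1[OF assms]) simp
qed

text \<open>Splitting off the factor with i = 1 and shifting the index replaces \<theta> by \<theta>
  + \<alpha> in the product over blocks. The rising factorial of \<theta> + \<alpha> + 1 undoes the
  normalization built into the weight of \<open>\<rho>\<close>.\<close>

lemma two_parameter_weight_add_mset:
  assumes "\<theta> + \<alpha> > 0" "0 \<notin># \<rho>" "\<rho> \<noteq> {#}"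
  shows "two_parameter_weight \<alpha> \<theta> (add_mset m \<rho>) =
    (\<theta> + \<alpha>) * pochhammer (1 - \<alpha>) (m - 1) * pochhammer (\<theta> + \<alpha> + 1) (sum_mset \<rho> - 1) /
      pochhammer (\<theta> + 1) (m + sum_mset \<rho> - 1) * two_parameter_weight \<alpha> (\<theta> + \<alpha>) \<rho>"
proof -
  have "pochhammer (\<theta> + \<alpha> + 1) (sum_mset \<rho> - 1) > 0"
    using assms(1) by (intro pochhammer_pos) simp
  moreover have "(\<Prod>i = 1..<Suc (size \<rho>). \<theta> + real i * \<alpha>) =
      (\<theta> + \<alpha>) * (\<Prod>i = 1..<size \<rho>. \<theta> + \<alpha> + real i * \<alpha>)"
  proof -
    have "size \<rho> \<ge> 1" using assms(3) by (simp add: Suc_le_eq nonempty_has_size)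
    then have "(\<Prod>i = 1..<Suc (size \<rho>). \<theta> + real i * \<alpha>) =
        (\<theta> + real 1 * \<alpha>) * (\<Prod>i = Suc 1..<Suc (size \<rho>). \<theta> + real i * \<alpha>)"
      by (intro prod.atLeast_Suc_lessThan) simp
    also have "(\<Prod>i = Suc 1..<Suc (size \<rho>). \<theta> + real i * \<alpha>) =
        (\<Prod>i = 1..<size \<rho>. \<theta> + real (Suc i) * \<alpha>)"
      by (rule prod.shift_bounds_Suc_ivl)
    finally show ?thesis by (simp add: algebra_simps)
  qed
  ultimately show ?thesis by (simp add: two_parameter_weight_def)
qed

text \<open>The block of size \<open>m\<close> uses up one of \<open>M\<close> colors, leaving
  \<open>M - 1\<close> for the rest. The power of \<open>M - 1\<close>, nonzero since
  \<open>M \<ge> 2\<close>, undoes the normalization of the remaining weight.\<close>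

lemma coupon_weight_add_mset:
  assumes "M \<ge> 2"
  shows "coupon_weight M (add_mset m \<rho>) =
    real M * real (M - 1) ^ sum_mset \<rho> / real M ^ (m + sum_mset \<rho>) * coupon_weight (M - 1) \<rho>"
proof -
  have "(\<Prod>i<Suc (size \<rho>). real M - real i) = real M * (\<Prod>i<size \<rho>. real (M - 1) - real i)"
    unfolding prod.lessThan_Suc_shift using assms by (simp add: of_nat_diff diff_diff_eq)
  then show ?thesis using assms by (simp add: coupon_weight_def)
qed

text \<open>Within the admissible range \<theta> + \<alpha> vanishes only for negative \<alpha> and
  M = 1, the partition into a single block.\<close>

lemma two_parameter_range_imp:
  assumes "two_parameter_range \<alpha> \<theta>" "\<theta> + \<alpha> \<noteq> 0"
  shows "\<theta> + \<alpha> > 0" "\<alpha> < 1" "\<theta> > -1"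
proof -
  show *: "\<theta> + \<alpha> > 0"
    using assms(1) unfolding two_parameter_range_def
  proof (elim disjE conjE exE)
    fix M :: nat assume "\<alpha> < 0" "M \<ge> 1" "\<theta> = - real M * \<alpha>"
    then have "\<theta> + \<alpha> = (real M - 1) * (- \<alpha>)" by (simp add: algebra_simps)
    moreover have "(real M - 1) * (- \<alpha>) \<ge> 0" using \<open>M \<ge> 1\<close> \<open>\<alpha> < 0\<close> by (intro mult_nonneg_nonneg) auto
    ultimately show ?thesis using assms(2) by linarith
  qed simp
  show "\<alpha> < 1" using assms(1) by (auto simp: two_parameter_range_def)
  then show "\<theta> > -1" using * by simp
qed

lemma two_parameter_weight_color_deletion:
  assumes ps: "partition_structure \<pi>" and range: "two_parameter_range \<alpha> \<theta>"
    and eppf: "\<And>\<mu>. 0 \<notin># \<mu> \<Longrightarrow> \<mu> \<noteq> {#} \<Longrightarrow> eppf \<pi> \<mu> = two_parameter_weight \<alpha> \<theta> \<mu>"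
    and pos: "eppf \<pi> {#1, 1#} > 0"
  shows "\<exists>\<pi>'. color_deletion_property \<pi> \<pi>'"
    and "color_deletion_property \<pi> \<pi>' \<Longrightarrow> 0 \<notin># \<rho> \<Longrightarrow> \<rho> \<noteq> {#} \<Longrightarrow>
      eppf \<pi>' \<rho> = two_parameter_weight \<alpha> (\<theta> + \<alpha>) \<rho>"
proof -
  \<comment> \<open>A positive value at two singletons excludes the one-block case.\<close>
  have "\<theta> + \<alpha> \<noteq> 0"
    using pos two_parameter_weight_add_1[of "{#1#}" \<alpha> \<theta>] by (auto simp: eppf)
  note imp = two_parameter_range_imp[OF range this]
  let ?Z = "\<lambda>m r. (\<theta> + \<alpha>) * pochhammer (1 - \<alpha>) (m - 1) * pochhammer (\<theta> + \<alpha> + 1) (r - 1) /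
      pochhammer (\<theta> + 1) (m + r - 1)"
  have Z: "?Z 1 r > 0" for r
    using imp by (intro divide_pos_pos mult_pos_pos pochhammer_pos) auto
  have prod: "eppf \<pi> (add_mset m \<rho>) = ?Z m (sum_mset \<rho>) * two_parameter_weight \<alpha> (\<theta> + \<alpha>) \<rho>"
    if "m \<ge> 1" "0 \<notin># \<rho>" "\<rho> \<noteq> {#}" for m \<rho>
    using eppf[of "add_mset m \<rho>"] two_parameter_weight_add_mset[OF imp(1) that(2,3)] that(1,2) by simp
  have th: "\<theta> + \<alpha> > -1" using imp by simp
  note * = color_deletion_of_product_form[OF ps prod Z two_parameter_weight_addition_rule[OF th]
      two_parameter_weight_singleton_1]
  show "\<exists>\<pi>'. color_deletion_property \<pi> \<pi>'" by (rule *(1))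
  show "color_deletion_property \<pi> \<pi>' \<Longrightarrow> 0 \<notin># \<rho> \<Longrightarrow> \<rho> \<noteq> {#} \<Longrightarrow>
      eppf \<pi>' \<rho> = two_parameter_weight \<alpha> (\<theta> + \<alpha>) \<rho>" by (rule *(2))
qed

lemma coupon_weight_color_deletion:
  assumes ps: "partition_structure \<pi>" and "M \<ge> 1"
    and eppf: "\<And>\<mu>. 0 \<notin># \<mu> \<Longrightarrow> \<mu> \<noteq> {#} \<Longrightarrow> eppf \<pi> \<mu> = coupon_weight M \<mu>"
    and pos: "eppf \<pi> {#1, 1#} > 0"
  shows "\<exists>\<pi>'. color_deletion_property \<pi> \<pi>'"
    and "color_deletion_property \<pi> \<pi>' \<Longrightarrow> 0 \<notin># \<rho> \<Longrightarrow> \<rho> \<noteq> {#} \<Longrightarrow>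
      eppf \<pi>' \<rho> = coupon_weight (M - 1) \<rho>"
proof -
  have "M \<noteq> 1" using pos by (auto simp: eppf coupon_weight_def)
  then have M: "M \<ge> 2" "M - 1 \<ge> 1" using \<open>M \<ge> 1\<close> by auto
  let ?Z = "\<lambda>m r. real M * real (M - 1) ^ r / real M ^ (m + r)"
  have Z: "?Z 1 r > 0" for r using M by simp
  have prod: "eppf \<pi> (add_mset m \<rho>) = ?Z m (sum_mset \<rho>) * coupon_weight (M - 1) \<rho>"
    if "m \<ge> 1" "0 \<notin># \<rho>" "\<rho> \<noteq> {#}" for m \<rho>
    using eppf[of "add_mset m \<rho>"] coupon_weight_add_mset[OF M(1)] that(1,2) by simp
  note * = color_deletion_of_product_form[OF ps prod Z coupon_weight_addition_rule[OF M(2)]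
      coupon_weight_singleton_1[OF M(2)]]
  show "\<exists>\<pi>'. color_deletion_property \<pi> \<pi>'" by (rule *(1))
  show "color_deletion_property \<pi> \<pi>' \<Longrightarrow> 0 \<notin># \<rho> \<Longrightarrow> \<rho> \<noteq> {#} \<Longrightarrow>
      eppf \<pi>' \<rho> = coupon_weight (M - 1) \<rho>" by (rule *(2))
qed

section \<open>Linearity of the transition probabilities\<close>

text \<open>
  \<open>H i j\<close> is the probability that \<open>i\<close> given trials of an exchangeable sequence
  succeed and \<open>j\<close> other given trials fail; \<open>X\<close> being the number of successes among the first \<open>N\<close>
  trials, the polynomial is the expectation of \<open>(X - t)\<^sup>2\<close>, computed by conditioning on the
  first trial.
\<close>
lemma second_moment_nonneg:
  fixes H :: "nat \<Rightarrow> nat \<Rightarrow> real"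
  assumes "\<And>i j. H i j \<ge> 0" "\<And>i j. H i j = H (Suc i) j + H i (Suc j)"
  shows "real N * (real N - 1) * H 2 0 + real N * H 1 0 - 2 * t * real N * H 1 0 + t\<^sup>2 * H 0 0 \<ge> 0"
  using assms
proof (induction N arbitrary: H t)
  case 0
  from 0(1)[of 0 0] show ?case by simp
next
  case (Suc N)
  have eq: "H 0 1 = H 0 0 - H 1 0" "H 1 1 = H 1 0 - H 2 0" "H 2 1 = H 2 0 - H 3 0"
  proof -
    have "H 0 0 = H 1 0 + H 0 1" "H 1 0 = H 2 0 + H 1 1" "H 2 0 = H 3 0 + H 2 1"
      using Suc.prems(2)[of 0 0] Suc.prems(2)[of 1 0] Suc.prems(2)[of 2 0]
      unfolding One_nat_def numeral_2_eq_2 numeral_3_eq_3 .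
    then show "H 0 1 = H 0 0 - H 1 0" "H 1 1 = H 1 0 - H 2 0" "H 2 1 = H 2 0 - H 3 0"
      by linarith+
  qed
  \<comment> \<open>If the first trial succeeds, the other \<open>N\<close> trials have to be
    compared with \<open>t - 1\<close>; if it fails, as in the inequality after this, with
    \<open>t\<close>. The two contributions add up to the claim for \<open>Suc N\<close>.\<close>
  have "real N * (real N - 1) * H 3 0 + real N * H 2 0 - 2 * (t - 1) * real N * H 2 0 + (t - 1)\<^sup>2 * H 1 0 \<ge> 0"
    using Suc.IH[of "\<lambda>i. H (Suc i)" "t - 1", OF Suc.prems(1) Suc.prems(2)]
    by (simp add: eval_nat_numeral)
  moreover have "real N * (real N - 1) * H 2 1 + real N * H 1 1 - 2 * t * real N * H 1 1 + t\<^sup>2 * H 0 1 \<ge> 0"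
    using Suc.IH[of "\<lambda>i j. H i (Suc j)" t, OF Suc.prems(1) Suc.prems(2)] by simp
  ultimately show ?case unfolding eq by (simp add: algebra_simps power2_eq_square)
qed

text \<open>With total mass \<open>H 0 0\<close>, a negative correlation of two trials would make
  the variance of the number of successes in \<open>N\<close> trials negative for large
  \<open>N\<close>.\<close>

lemma exchangeable_log_convex:
  fixes H :: "nat \<Rightarrow> nat \<Rightarrow> real"
  assumes nonneg: "\<And>i j. H i j \<ge> 0" and rec: "\<And>i j. H i j = H (Suc i) j + H i (Suc j)"
    and pos: "H 0 0 > 0"
  shows "(H 1 0)\<^sup>2 \<le> H 0 0 * H 2 0"
proof (rule ccontr)
  assume "\<not> ?thesis"
  then have \<delta>: "(H 1 0)\<^sup>2 - H 0 0 * H 2 0 > 0" (is "?\<delta> > 0") by simp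
  then obtain N :: nat where N: "H 0 0 * H 1 0 < real N * ?\<delta>"
    using reals_Archimedean3 by blast
  have "H 0 0 * H 1 0 \<ge> 0" using nonneg by simp
  then have "real N > 0" using N by (cases "N = 0") auto
  \<comment> \<open>The success probability of one trial; \<open>t = real N * x\<close> is the mean,
    at which the quadratic in \<open>t\<close> is smallest.\<close>
  define x where "x = H 1 0 / H 0 0"
  have "0 \<le> real N * (real N - 1) * H 2 0 + real N * H 1 0 - 2 * (real N * x) * real N * H 1 0
      + (real N * x)\<^sup>2 * H 0 0"
    using second_moment_nonneg[of H N "real N * x"] nonneg rec by blast
  then have "0 \<le> H 0 0 * (real N * (real N - 1) * H 2 0 + real N * H 1 0 - 2 * (real N * x) * real N * H 1 0
      + (real N * x)\<^sup>2 * H 0 0)"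
    using pos by simp
  also have "\<dots> = real N * ((real N - 1) * (H 0 0 * H 2 0) + H 0 0 * H 1 0 - 2 * real N * (x * H 0 0) * H 1 0
      + real N * (x * H 0 0)\<^sup>2)"
    by (simp add: algebra_simps power2_eq_square)
  also have "x * H 0 0 = H 1 0" using pos by (simp add: x_def)
  finally have "0 \<le> (real N - 1) * (H 0 0 * H 2 0) + H 0 0 * H 1 0 - 2 * real N * H 1 0 * H 1 0
      + real N * (H 1 0)\<^sup>2"
    using \<open>real N > 0\<close> by (metis mult_le_cancel_left_pos mult_zero_right)
  also have "\<dots> = (real N - 1) * (H 0 0 * H 2 0) + H 0 0 * H 1 0 - real N * (H 1 0)\<^sup>2"
    by (simp add: power2_eq_square)
  also have "\<dots> = H 0 0 * H 1 0 - real N * ?\<delta> - H 0 0 * H 2 0" by (simp add: algebra_simps)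
  finally show False using N mult_nonneg_nonneg[OF nonneg[of 0 0] nonneg[of 2 0]] by linarith
qed

section \<open>Uniqueness under a prediction rule\<close>

lemma size_le_sum_mset: "0 \<notin># \<mu> \<Longrightarrow> size \<mu> \<le> sum_mset \<mu>"
  by (induction \<mu>) (auto simp: Suc_le_eq)

text \<open>Balls are removed one at a time: from a block with at least two balls if there is one,
  otherwise a whole singleton as long as three blocks are present. At least two blocks remain
  throughout, and the descent ends at two singletons.\<close>

lemma prediction_rule_unique:
  fixes f h :: "nat multiset \<Rightarrow> real"
  assumes f_Suc: "\<And>a \<rho>. a \<ge> 1 \<Longrightarrow> 0 \<notin># \<rho> \<Longrightarrow> \<rho> \<noteq> {#} \<Longrightarrow> f (add_mset (Suc a) \<rho>) = g a \<rho> * f (add_mset a \<rho>)"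
    and h_Suc: "\<And>a \<rho>. a \<ge> 1 \<Longrightarrow> 0 \<notin># \<rho> \<Longrightarrow> \<rho> \<noteq> {#} \<Longrightarrow> h (add_mset (Suc a) \<rho>) = g a \<rho> * h (add_mset a \<rho>)"
    and f_new: "\<And>\<mu>. 0 \<notin># \<mu> \<Longrightarrow> size \<mu> \<ge> 2 \<Longrightarrow> f (add_mset 1 \<mu>) = k \<mu> * f \<mu>"
    and h_new: "\<And>\<mu>. 0 \<notin># \<mu> \<Longrightarrow> size \<mu> \<ge> 2 \<Longrightarrow> h (add_mset 1 \<mu>) = k \<mu> * h \<mu>"
    and base: "f {#1, 1#} = h {#1, 1#}"
    and "0 \<notin># \<mu>" "size \<mu> \<ge> 2"
  shows "f \<mu> = h \<mu>"
  using assms(6,7)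
proof (induction "sum_mset \<mu>" arbitrary: \<mu> rule: less_induct)
  case less
  show ?case
  proof (cases "\<exists>x\<in>#\<mu>. x \<ge> 2")
    case True
    then obtain x where x: "x \<in># \<mu>" "x \<ge> 2" by blast
    define a \<rho> where "a = x - 1" and "\<rho> = \<mu> - {#x#}"
    have \<mu>: "\<mu> = add_mset (Suc a) \<rho>" and a: "a \<ge> 1" using x by (auto simp: a_def \<rho>_def)
    have "0 \<notin># \<rho>" "\<rho> \<noteq> {#}" using less.prems unfolding \<mu> by auto
    moreover from this have "f (add_mset a \<rho>) = h (add_mset a \<rho>)"
      using less.prems a unfolding \<mu> by (intro less.hyps) (auto simp: \<mu>)
    ultimately show ?thesis using f_Suc h_Suc a unfolding \<mu> by simp
  next
    case False
    obtain x \<rho> where \<mu>: "\<mu> = add_mset x \<rho>" using less.prems(2) by (cases \<mu>) auto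
    have x: "x = 1" using False less.prems(1) unfolding \<mu> by (cases x) auto
    have \<rho>: "0 \<notin># \<rho>" using less.prems(1) \<mu> by simp
    show ?thesis
    proof (cases "size \<rho> \<ge> 2")
      case True
      then have "f \<rho> = h \<rho>" using \<rho> by (intro less.hyps) (auto simp: \<mu> x)
      then show ?thesis using f_new[OF \<rho> True] h_new[OF \<rho> True] by (simp add: \<mu> x)
    next
      case False
      then have "size \<rho> = 1" using less.prems(2) by (simp add: \<mu>)
      then obtain y where y: "\<rho> = {#y#}" using size_1_singleton_mset by blast
      then have "y = 1" using \<open>\<not> (\<exists>x\<in>#\<mu>. x \<ge> 2)\<close> \<rho> unfolding \<mu> by (cases y) auto
      then show ?thesis using base by (simp add: \<mu> x y)
    qed
  qed
qed

text \<open>Sums \<open>f\<close> over all ways of adding \<open>j\<close> balls, none of them to the distinguished block of size \<open>a\<close>.\<close>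
primrec avoiding_sum :: "(nat multiset \<Rightarrow> real) \<Rightarrow> nat \<Rightarrow> nat \<Rightarrow> nat multiset \<Rightarrow> real" where
  "avoiding_sum f 0 a \<rho> = f (add_mset a \<rho>)"
| "avoiding_sum f (Suc j) a \<rho> =
     (\<Sum>y\<in>#\<rho>. avoiding_sum f j a (add_mset (Suc y) (\<rho> - {#y#}))) + avoiding_sum f j a (add_mset 1 \<rho>)"

section \<open>Consequences of the addition rule alone\<close>

context
  fixes f :: "nat multiset \<Rightarrow> real" and \<gamma> :: "nat \<Rightarrow> nat \<Rightarrow> real"
  assumes nonneg: "\<And>\<mu>. f \<mu> \<ge> 0"
    and addition: "\<And>\<nu>. 0 \<notin># \<nu> \<Longrightarrow> \<nu> \<noteq> {#} \<Longrightarrow>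
      f \<nu> = (\<Sum>y\<in>#\<nu>. f (add_mset (Suc y) (\<nu> - {#y#}))) + f (add_mset 1 \<nu>)"
begin

lemma addition_distinguished:
  assumes "a \<ge> 1" "0 \<notin># \<rho>"
  shows "f (add_mset a \<rho>) = f (add_mset (Suc a) \<rho>) +
    ((\<Sum>y\<in>#\<rho>. f (add_mset a (add_mset (Suc y) (\<rho> - {#y#})))) + f (add_mset a (add_mset 1 \<rho>)))"
proof -
  have "(\<Sum>y\<in>#\<rho>. f (add_mset (Suc y) (add_mset a \<rho> - {#y#}))) =
      (\<Sum>y\<in>#\<rho>. f (add_mset a (add_mset (Suc y) (\<rho> - {#y#}))))"
    by (intro arg_cong[where f = sum_mset] image_mset_cong) (simp add: add_mset_commute)
  moreover have "f (add_mset a \<rho>) = (\<Sum>y\<in>#add_mset a \<rho>. f (add_mset (Suc y) (add_mset a \<rho> - {#y#}))) +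
      f (add_mset 1 (add_mset a \<rho>))"
    using assms by (intro addition) auto
  ultimately show ?thesis by (simp add: add_mset_commute[of "Suc 0" a])
qed

lemma avoiding_sum_nonneg: "avoiding_sum f j a \<rho> \<ge> 0"
proof (induction j arbitrary: \<rho>)
  case (Suc j)
  have "(\<Sum>y\<in>#\<rho>. avoiding_sum f j a (add_mset (Suc y) (\<rho> - {#y#}))) \<ge> 0"
    unfolding sum_mset_image_mset_count using Suc by (intro sum_nonneg) auto
  then show ?case using Suc by simp
qed (simp add: nonneg)

text \<open>One further ball either joins the distinguished block or avoids it. The induction
  applies this below the first of the \<open>j\<close> avoiding balls.\<close>

lemma avoiding_sum_rec:
  assumes "a \<ge> 1" "0 \<notin># \<rho>"
  shows "avoiding_sum f j a \<rho> = avoiding_sum f j (Suc a) \<rho> + avoiding_sum f (Suc j) a \<rho>"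
  using assms(2)
proof (induction j arbitrary: \<rho>)
  case 0
  from addition_distinguished[OF assms(1) 0] show ?case by simp
next
  case (Suc j)
  have "0 \<notin># add_mset (Suc y) (\<rho> - {#y#})" for y using Suc.prems by (auto dest: in_diffD)
  from Suc.IH[OF this] have IH: "avoiding_sum f j a (add_mset (Suc y) (\<rho> - {#y#})) =
      avoiding_sum f j (Suc a) (add_mset (Suc y) (\<rho> - {#y#})) +
      avoiding_sum f (Suc j) a (add_mset (Suc y) (\<rho> - {#y#}))" for y .
  have "0 \<notin># add_mset 1 \<rho>" using Suc.prems by simp
  note IH1 = Suc.IH[OF this]
  have "avoiding_sum f (Suc j) a \<rho> =
      (\<Sum>y\<in>#\<rho>. avoiding_sum f j (Suc a) (add_mset (Suc y) (\<rho> - {#y#})) +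
        avoiding_sum f (Suc j) a (add_mset (Suc y) (\<rho> - {#y#}))) +
      (avoiding_sum f j (Suc a) (add_mset 1 \<rho>) + avoiding_sum f (Suc j) a (add_mset 1 \<rho>))"
    by (simp only: avoiding_sum.simps(2)[of f j a \<rho>] IH IH1)
  also have "\<dots> = avoiding_sum f (Suc j) (Suc a) \<rho> + avoiding_sum f (Suc (Suc j)) a \<rho>"
    by (simp only: avoiding_sum.simps(2)[of f j "Suc a" \<rho>] avoiding_sum.simps(2)[of f "Suc j" a \<rho>]
        sum_mset.distrib add_ac)
  finally show ?case .
qed

text \<open>A trial succeeds if the added ball joins the distinguished block; \<open>i\<close>
  successes and \<open>j\<close> failures have mass
  \<open>avoiding_sum f j (a + i) \<rho>\<close>.\<close>

lemma block_log_convex: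
  assumes "a \<ge> 1" "0 \<notin># \<rho>" "f (add_mset a \<rho>) > 0"
  shows "(f (add_mset (Suc a) \<rho>))\<^sup>2 \<le> f (add_mset a \<rho>) * f (add_mset (Suc (Suc a)) \<rho>)"
proof -
  have "(avoiding_sum f 0 (a + 1) \<rho>)\<^sup>2 \<le> avoiding_sum f 0 (a + 0) \<rho> * avoiding_sum f 0 (a + 2) \<rho>"
  proof (rule exchangeable_log_convex[of "\<lambda>i j. avoiding_sum f j (a + i) \<rho>"])
    show "avoiding_sum f j (a + i) \<rho> =
        avoiding_sum f j (a + Suc i) \<rho> + avoiding_sum f (Suc j) (a + i) \<rho>" for i j
      unfolding add_Suc_right by (rule avoiding_sum_rec) (use assms(1,2) in auto)
    show "avoiding_sum f 0 (a + 0) \<rho> > 0" using assms(3) by simp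
  qed (rule avoiding_sum_nonneg)
  then show ?thesis by simp
qed

lemma add_block_Suc_le:
  assumes "a \<ge> 1" "0 \<notin># \<rho>"
  shows "f (add_mset (Suc a) \<rho>) \<le> f (add_mset a \<rho>)"
  using avoiding_sum_rec[OF assms, of 0] avoiding_sum_nonneg[of 1 a \<rho>] by simp

lemma add_singleton_le:
  assumes "0 \<notin># \<nu>" "\<nu> \<noteq> {#}"
  shows "f (add_mset 1 \<nu>) \<le> f \<nu>"
proof -
  have "(\<Sum>y\<in>#\<nu>. f (add_mset (Suc y) (\<nu> - {#y#}))) \<ge> 0"
    unfolding sum_mset_image_mset_count using nonneg by (intro sum_nonneg) auto
  then show ?thesis using addition[OF assms] by simp
qed

section \<open>Growth of a block governed by its size and the number of balls\<close>

context
  assumes transition: "\<And>a \<rho>. a \<ge> 1 \<Longrightarrow> 0 \<notin># \<rho> \<Longrightarrow> \<rho> \<noteq> {#} \<Longrightarrow>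
      f (add_mset (Suc a) \<rho>) = \<gamma> a (a + sum_mset \<rho>) * f (add_mset a \<rho>)"
begin

text \<open>A ball is added to each of two blocks in either order. Each of the two serves as the
  nonempty rest for the other, so \<open>\<rho>\<close> may be empty.\<close>

lemma transition_commute:
  assumes "a \<ge> 1" "b \<ge> 1" "0 \<notin># \<rho>" "f (add_mset a (add_mset b \<rho>)) > 0" "n = a + b + sum_mset \<rho>"
  shows "\<gamma> a n * \<gamma> b (Suc n) = \<gamma> b n * \<gamma> a (Suc n)"
proof -
  have "f (add_mset (Suc a) (add_mset (Suc b) \<rho>)) = \<gamma> a (Suc n) * (\<gamma> b n * f (add_mset a (add_mset b \<rho>)))"
    using transition[of a "add_mset (Suc b) \<rho>"] transition[of b "add_mset a \<rho>"] assms
    by (simp add: add_mset_commute[of "Suc b" a] add_mset_commute[of b a] add_ac)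
  moreover have "f (add_mset (Suc a) (add_mset (Suc b) \<rho>)) = \<gamma> b (Suc n) * (\<gamma> a n * f (add_mset a (add_mset b \<rho>)))"
    using transition[of b "add_mset (Suc a) \<rho>"] transition[of a "add_mset b \<rho>"] assms
    by (simp add: add_mset_commute[of "Suc b" "Suc a"] add_mset_commute[of b "Suc a"] add_ac)
  ultimately show ?thesis using assms(4) by (simp add: mult_ac)
qed

lemma add_singleton:
  assumes "0 \<notin># \<nu>" "size \<nu> \<ge> 2"
  shows "f (add_mset 1 \<nu>) = (1 - (\<Sum>y\<in>#\<nu>. \<gamma> y (sum_mset \<nu>))) * f \<nu>"
proof -
  have "f (add_mset (Suc y) (\<nu> - {#y#})) = \<gamma> y (sum_mset \<nu>) * f \<nu>" if y: "y \<in># \<nu>" for y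
  proof -
    have "y \<ge> 1" using y assms(1) by (cases y) auto
    moreover have "0 \<notin># \<nu> - {#y#}" using assms(1) by (meson in_diffD)
    moreover have "size (\<nu> - {#y#}) \<ge> 1" using assms(2) y by (simp add: size_Diff_singleton)
    then have "\<nu> - {#y#} \<noteq> {#}" by force
    moreover have "add_mset y (\<nu> - {#y#}) = \<nu>" using y by simp
    moreover have "y + sum_mset (\<nu> - {#y#}) = sum_mset \<nu>" using sum_mset.remove[OF y] by simp
    ultimately show ?thesis using transition[of y "\<nu> - {#y#}"] by simp
  qed
  then have "(\<Sum>y\<in>#\<nu>. f (add_mset (Suc y) (\<nu> - {#y#}))) = (\<Sum>y\<in>#\<nu>. \<gamma> y (sum_mset \<nu>) * f \<nu>)"
    by (intro arg_cong[where f = sum_mset] image_mset_cong)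
  also have "\<dots> = (\<Sum>y\<in>#\<nu>. \<gamma> y (sum_mset \<nu>)) * f \<nu>" by (simp add: sum_mset_distrib_right)
  finally show ?thesis using addition[of \<nu>] assms by (cases "\<nu> = {#}") (auto simp: algebra_simps)
qed

text \<open>Starting from two blocks, the block of size \<open>a\<close> grows before or after a
  singleton is added. The new-block probability after the growth involves
  \<open>\<gamma> (Suc a) (Suc n)\<close>, which brings in the next block size.\<close>

lemma transition_new_block:
  assumes "a \<ge> 1" "b \<ge> 1" "f {#a, b#} > 0" "n = a + b"
  shows "\<gamma> a n * (1 - \<gamma> (Suc a) (Suc n) - \<gamma> b (Suc n)) = \<gamma> a (Suc n) * (1 - \<gamma> a n - \<gamma> b n)"
proof -
  have "f {#1, Suc a, b#} = (1 - \<gamma> (Suc a) (Suc n) - \<gamma> b (Suc n)) * (\<gamma> a n * f {#a, b#})"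
    using add_singleton[of "{#Suc a, b#}"] transition[of a "{#b#}"] assms by (simp add: algebra_simps)
  moreover have "f {#Suc a, 1, b#} = \<gamma> a (Suc n) * ((1 - \<gamma> a n - \<gamma> b n) * f {#a, b#})"
  proof -
    have "f {#a, 1, b#} = f {#1, a, b#}" by (simp only: add_mset_commute[of 1 a])
    moreover have "f {#1, a, b#} = (1 - \<gamma> a n - \<gamma> b n) * f {#a, b#}"
      using add_singleton[of "{#a, b#}"] assms by (simp add: algebra_simps)
    moreover have "f {#Suc a, 1, b#} = \<gamma> a (Suc n) * f {#a, 1, b#}"
      using transition[of a "{#1, b#}"] assms by simp
    ultimately show ?thesis by metis
  qed
  moreover have "{#1, Suc a, b#} = {#Suc a, 1, b#}" by (rule add_mset_commute)
  ultimately have "(\<gamma> a n * (1 - \<gamma> (Suc a) (Suc n) - \<gamma> b (Suc n))) * f {#a, b#} =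
      (\<gamma> a (Suc n) * (1 - \<gamma> a n - \<gamma> b n)) * f {#a, b#}"
    by (simp only: mult_ac)
  then show ?thesis using assms(3) by simp
qed

text \<open>Positivity for three blocks is needed to compare the transition probabilities of two
  arbitrary block sizes.\<close>
definition linear_at :: "nat \<Rightarrow> real \<Rightarrow> real \<Rightarrow> bool" where
  "linear_at n s d \<longleftrightarrow> s + d > 0 \<and> d \<ge> 0 \<and> (\<forall>a. 1 \<le> a \<and> a < n \<longrightarrow> \<gamma> a n = s + d * real a) \<and>
     (\<forall>a b. a \<ge> 1 \<and> b \<ge> 1 \<and> a + b = n \<longrightarrow> f {#a, b#} > 0) \<and>
     (\<forall>a b c. a \<ge> 1 \<and> b \<ge> 1 \<and> c \<ge> 1 \<and> a + b + c = n \<longrightarrow> f {#a, b, c#} > 0)"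

text \<open>Commutation makes the transition probabilities at \<open>Suc n\<close> a common multiple
  \<open>c\<close> of those at \<open>n\<close>, for all sizes below \<open>n\<close>. The new-block
  relation then determines \<open>c\<close> and supplies the one missing size
  \<open>n\<close>.\<close>

lemma linear_at_Suc:
  assumes "n \<ge> 3" "linear_at n s d"
  shows "linear_at (Suc n) (s / (1 + d)) (d / (1 + d))"
proof -
  have sd: "s + d > 0" "d \<ge> 0" and lin: "\<And>a. 1 \<le> a \<Longrightarrow> a < n \<Longrightarrow> \<gamma> a n = s + d * real a"
    and f2: "\<And>a b. a \<ge> 1 \<Longrightarrow> b \<ge> 1 \<Longrightarrow> a + b = n \<Longrightarrow> f {#a, b#} > 0"
    and f3: "\<And>a b c. a \<ge> 1 \<Longrightarrow> b \<ge> 1 \<Longrightarrow> c \<ge> 1 \<Longrightarrow> a + b + c = n \<Longrightarrow> f {#a, b, c#} > 0"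
    using assms(2) by (auto simp: linear_at_def)
  have pos: "\<gamma> a n > 0" if "1 \<le> a" "a < n" for a
  proof -
    have "d * real a \<ge> d * 1" using sd that by (intro mult_left_mono) auto
    then show ?thesis using lin[OF that] sd by simp
  qed
  have f2': "f {#Suc a, b#} > 0" if "a \<ge> 1" "b \<ge> 1" "a + b = n" for a b
    using transition[of a "{#b#}"] pos[of a] f2[OF that] that by simp
  have f3': "f {#Suc a, b, c#} > 0" if "a \<ge> 1" "b \<ge> 1" "c \<ge> 1" "a + b + c = n" for a b c
    using transition[of a "{#b, c#}"] pos[of a] f3[OF that] that by (simp add: add_ac)
  have F2: "f {#a, b#} > 0" if "a \<ge> 1" "b \<ge> 1" "a + b = Suc n" for a b
  proof (cases "a \<ge> 2")
    case True
    then show ?thesis using f2'[of "a - 1" b] that by simp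
  next
    case False
    then have "f {#b, a#} > 0" using f2'[of "b - 1" a] that assms(1) by simp
    then show ?thesis by (simp add: add_mset_commute)
  qed
  have F3: "f {#a, b, c#} > 0" if "a \<ge> 1" "b \<ge> 1" "c \<ge> 1" "a + b + c = Suc n" for a b c
  proof -
    \<comment> \<open>Three blocks with at least four balls: some block has grown from a
      configuration of \<open>n\<close> balls.\<close>
    have "a \<ge> 2 \<or> b \<ge> 2 \<or> c \<ge> 2" using that assms(1) by linarith
    then consider "a \<ge> 2" | "b \<ge> 2" | "c \<ge> 2" by blast
    then show ?thesis
    proof cases
      case 1
      then show ?thesis using f3'[of "a - 1" b c] that by simp
    next
      case 2
      then have "f {#b, a, c#} > 0" using f3'[of "b - 1" a c] that by simp
      then show ?thesis by (simp add: add_mset_commute[of b a])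
    next
      case 3
      then have "f {#c, a, b#} > 0" using f3'[of "c - 1" a b] that by simp
      then show ?thesis by (simp add: add_mset_commute[of c])
    qed
  qed
  define c where "c = \<gamma> 1 (Suc n) / \<gamma> 1 n"
  have p1: "\<gamma> 1 n > 0" using pos[of 1] assms(1) by simp
  have ratio: "\<gamma> a (Suc n) = c * \<gamma> a n" if a: "1 \<le> a" "a < n" for a
  proof -
    have "\<gamma> a n * \<gamma> 1 (Suc n) = \<gamma> 1 n * \<gamma> a (Suc n)"
    \<comment> \<open>Blocks of sizes \<open>a\<close> and 1 are compared. Unless they already
      exhaust the \<open>n\<close> balls, the rest forms a third block.\<close>
    proof (cases "a = n - 1")
      case True
      then have "f {#a, 1#} > 0" using a by (intro f2) auto
      then show ?thesis using True a by (intro transition_commute[of a 1 "{#}" n]) auto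
    next
      case False
      then have "f {#a, 1, n - 1 - a#} > 0" using a by (intro f3) auto
      then show ?thesis using False a by (intro transition_commute[of a 1 "{#n - 1 - a#}" n]) auto
    qed
    then show ?thesis using p1 by (simp add: c_def field_simps)
  qed
  have new: "1 - \<gamma> (Suc a) (Suc n) = c * (1 - \<gamma> a n)" if a: "1 \<le> a" "a < n" for a
  proof -
    have "\<gamma> a n * (1 - \<gamma> (Suc a) (Suc n) - c * \<gamma> (n - a) n) = c * \<gamma> a n * (1 - \<gamma> a n - \<gamma> (n - a) n)"
      using transition_new_block[of a "n - a" n] f2[of a "n - a"] ratio[OF a] ratio[of "n - a"] a by simp
    then have "1 - \<gamma> (Suc a) (Suc n) - c * \<gamma> (n - a) n = c * (1 - \<gamma> a n - \<gamma> (n - a) n)"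
      using pos[OF a] by (simp add: mult_ac)
    then show ?thesis by (simp add: algebra_simps)
  qed
  \<comment> \<open>Two expressions for \<open>\<gamma> 2 (Suc n)\<close>: one from
    \<open>ratio\<close>, which needs \<open>2 < n\<close>, and one from \<open>new\<close> with
    \<open>a = 1\<close>.\<close>
  have "1 - c * (s + d * 2) = c * (1 - (s + d))"
    using new[of 1] ratio[of 2] lin[of 1] lin[of 2] assms(1) by (simp add: eval_nat_numeral)
  then have "c * (1 + d) = 1" by (simp add: algebra_simps)
  then have c: "c = 1 / (1 + d)" using sd by (simp add: field_simps)
  \<comment> \<open>Sizes below \<open>n\<close> come from \<open>ratio\<close>; size
    \<open>n\<close> comes from \<open>new\<close> applied to its predecessor.\<close>
  have "\<gamma> a (Suc n) = s / (1 + d) + d / (1 + d) * real a" if a: "1 \<le> a" "a < Suc n" for a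
  proof (cases "a = n")
    case False
    then show ?thesis using ratio[of a] lin[of a] a sd by (simp add: c add_divide_distrib)
  next
    case True
    then obtain b where b: "a = Suc b" "1 \<le> b" "b < n" using assms(1) by (cases a) auto
    have "\<gamma> a (Suc n) = 1 - (1 - (s + d * real b)) / (1 + d)"
      using new[OF b(2,3)] lin[OF b(2,3)] unfolding c b(1) by simp
    also have "\<dots> = ((1 + d) - (1 - (s + d * real b))) / (1 + d)"
    proof -
      have "1 - X / D = (D - X) / D" if "D > 0" for X D :: real
        using that by (simp add: diff_divide_distrib)
      then show ?thesis using sd by simp
    qed
    also have "\<dots> = (s + d * real a) / (1 + d)"
      by (simp add: b(1) algebra_simps)
    also have "\<dots> = s / (1 + d) + d / (1 + d) * real a"
      by (simp add: add_divide_distrib)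
    finally show ?thesis .
  qed
  then show ?thesis using sd F2 F3 by (auto simp: linear_at_def simp flip: add_divide_distrib)
qed

text \<open>All these partitions arise from {2, 2, 1} by deleting balls, and \<open>f\<close> cannot
  decrease under such deletions.\<close>

lemma small_positive:
  assumes "f {#2, 2, 1#} > 0"
  shows "f {#1, 1, 1#} > 0" "f {#2, 1, 1#} > 0" "f {#2, 1#} > 0" "f {#1, 1#} > 0"
proof -
  have "f {#2, 2, 1#} \<le> f {#1, 2, 1#}"
    using add_block_Suc_le[of 1 "{#2, 1#}"] by (simp add: eval_nat_numeral)
  moreover have f121: "f {#1, 2, 1#} = f {#2, 1, 1#}" by (simp only: add_mset_commute[of 1 2])
  ultimately show f211: "f {#2, 1, 1#} > 0" using assms by linarith
  have "f {#2, 1, 1#} \<le> f {#1, 1, 1#}"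
    using add_block_Suc_le[of 1 "{#1, 1#}"] by (simp add: eval_nat_numeral)
  then show "f {#1, 1, 1#} > 0" using f211 by simp
  then show "f {#1, 1#} > 0" using add_singleton_le[of "{#1, 1#}"] by simp
  have "f {#1, 2, 1#} \<le> f {#2, 1#}" using add_singleton_le[of "{#2, 1#}"] by simp
  then show "f {#2, 1#} > 0" using f211 f121 by linarith
qed

text \<open>Two values always lie on a line, so only the sign of its slope has content:
  log-convexity gives \<open>\<gamma> 1 2 \<le> \<gamma> 2 3\<close>, and the new-block relation
  turns this into \<open>\<gamma> 1 3 \<le> \<gamma> 1 2\<close>. The equation for
  \<open>\<gamma> 1 2\<close> later extends the closed form down to two balls.\<close>

lemma linear_at_3:
  assumes "f {#2, 2, 1#} > 0"
  obtains s d where "linear_at 3 s d" "\<gamma> 1 2 * (1 - d) = s + d" "d < 1" "\<gamma> 1 2 > 0"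
proof -
  note pos = small_positive[OF assms]
  define s d where "s = 2 * \<gamma> 1 3 - \<gamma> 2 3" and "d = \<gamma> 2 3 - \<gamma> 1 3"
  have "f {#2, 1#} = \<gamma> 1 2 * f {#1, 1#}" "f {#3, 1#} = \<gamma> 2 3 * f {#2, 1#}"
    "f {#2, 1, 1#} = \<gamma> 1 3 * f {#1, 1, 1#}"
    using transition[of 1 "{#1#}"] transition[of 2 "{#1#}"] transition[of 1 "{#1, 1#}"]
    by (simp_all add: eval_nat_numeral)
  note tr = this
  have g: "\<gamma> 1 2 > 0" "\<gamma> 1 3 > 0" using tr(1,3) pos by (auto simp: zero_less_mult_iff)
  have "f {#1, 1, 1#} = (1 - 2 * \<gamma> 1 2) * f {#1, 1#}"
    using add_singleton[of "{#1, 1#}"] by (simp add: eval_nat_numeral)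
  then have half: "\<gamma> 1 2 < 1 / 2" using pos by (auto simp: zero_less_mult_iff)
  have new: "\<gamma> 1 2 * (1 - \<gamma> 2 3 - \<gamma> 1 3) = \<gamma> 1 3 * (1 - 2 * \<gamma> 1 2)"
    using transition_new_block[of 1 1 2] pos by (simp add: eval_nat_numeral)
  have "(f {#2, 1#})\<^sup>2 \<le> f {#1, 1#} * f {#3, 1#}"
    using block_log_convex[of 1 "{#1#}"] pos by (simp add: eval_nat_numeral)
  then have "f {#2, 1#} * (\<gamma> 1 2 * f {#1, 1#}) \<le> f {#2, 1#} * (\<gamma> 2 3 * f {#1, 1#})"
    using tr(1,2) by (simp add: power2_eq_square mult_ac)
  then have "\<gamma> 1 2 \<le> \<gamma> 2 3" using pos by simp
  moreover have "\<gamma> 1 3 \<le> \<gamma> 1 2"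
  proof -
    \<comment> \<open>The term \<open>\<gamma> 1 2 * \<gamma> 1 3\<close> of the new-block relation
      is split between the two sides.\<close>
    have "\<gamma> 1 3 * (1 - \<gamma> 1 2) = \<gamma> 1 2 * (1 - \<gamma> 2 3)" using new by (simp add: algebra_simps)
    also have "\<dots> \<le> \<gamma> 1 2 * (1 - \<gamma> 1 2)" using g \<open>\<gamma> 1 2 \<le> \<gamma> 2 3\<close> by (intro mult_left_mono) auto
    finally show ?thesis using half by simp
  qed
  ultimately have "d \<ge> 0" by (simp add: d_def)
  moreover have "s + d > 0" using g by (simp add: s_def d_def)
  moreover have "\<gamma> a 3 = s + d * real a" if "1 \<le> a" "a < 3" for a
  proof -
    have "a = 1 \<or> a = 2" using that by auto
    then show ?thesis by (auto simp: s_def d_def)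
  qed
  moreover have "f {#a, b#} > 0" if "a \<ge> 1" "b \<ge> 1" "a + b = 3" for a b :: nat
  proof -
    have "a = 1 \<and> b = 2 \<or> a = 2 \<and> b = 1" using that by auto
    moreover have "f {#1, 2#} = f {#2, 1#}" by (simp only: add_mset_commute[of 1 2])
    ultimately show ?thesis using pos(3) by auto
  qed
  moreover have "f {#a, b, c#} > 0" if "a \<ge> 1" "b \<ge> 1" "c \<ge> 1" "a + b + c = 3" for a b c :: nat
  proof -
    have "a = 1 \<and> b = 1 \<and> c = 1" using that by auto
    then show ?thesis using pos(1) by simp
  qed
  ultimately have "linear_at 3 s d" by (simp add: linear_at_def)
  moreover have eq: "\<gamma> 1 2 * (1 - d) = s + d" using new by (simp add: s_def d_def algebra_simps)
  moreover have "d < 1"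
    using eq g \<open>s + d > 0\<close> by (metis diff_gt_0_iff_gt zero_less_mult_pos)
  ultimately show thesis using that g by blast
qed

text \<open>Passing from d to d / (1 + d) increases 1/d by 1, so a positive slope at n is the
  reciprocal of n + \<theta>, while slope 0 and the value \<open>s\<close> are preserved.\<close>

lemma transition_closed_form:
  assumes "f {#2, 2, 1#} > 0"
  obtains (linear_rate) \<alpha> \<theta> where "\<alpha> < 1" "\<theta> > -2"
      "\<And>a n. 1 \<le> a \<Longrightarrow> a < n \<Longrightarrow> \<gamma> a n = (real a - \<alpha>) / (real n + \<theta>)"
  | (constant_rate) s where "s > 0" "\<And>a n. 1 \<le> a \<Longrightarrow> a < n \<Longrightarrow> \<gamma> a n = s"
proof -
  obtain s d where sd: "linear_at 3 s d" "\<gamma> 1 2 * (1 - d) = s + d" "d < 1" "\<gamma> 1 2 > 0"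
    using linear_at_3[OF assms] by blast
  have d: "d \<ge> 0" "s + d > 0" using sd(1) by (auto simp: linear_at_def)
  show thesis
  proof (cases "d = 0")
    case True
    have lin: "linear_at n s 0" if "n \<ge> 3" for n
      using that
    proof (induction n rule: nat_induct_at_least)
      case base
      then show ?case using sd(1) True by simp
    next
      case (Suc n)
      then show ?case using linear_at_Suc[of n s 0] by simp
    qed
    have "\<gamma> a n = s" if a: "1 \<le> a" "a < n" for a n
    proof (cases "n \<ge> 3")
      case True
      then show ?thesis using lin[of n] a by (simp add: linear_at_def)
    next
      case False
      then have "a = 1" "n = 2" using a by auto
      then show ?thesis using sd(2) \<open>d = 0\<close> by simp
    qed
    then show thesis using constant_rate d True by simp
  next
    case False
    \<comment> \<open>Solved from d = 1 / (3 + \<theta>) and s = - \<alpha> / (3 + \<theta>). The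
      bound \<open>d < 1\<close> becomes \<theta> > -2, and s + d > 0 becomes \<alpha> < 1.\<close>
    define \<theta> \<alpha> where "\<theta> = 1 / d - 3" and "\<alpha> = - s / d"
    have dpos: "d > 0" using d False by simp
    have \<theta>: "\<theta> > -2" using dpos sd(3) by (simp add: \<theta>_def field_simps)
    have lin: "linear_at n (- \<alpha> / (real n + \<theta>)) (1 / (real n + \<theta>))" if "n \<ge> 3" for n
      using that
    proof (induction n rule: nat_induct_at_least)
      case base
      have "- \<alpha> / (real 3 + \<theta>) = s" "1 / (real 3 + \<theta>) = d"
        using dpos by (simp_all add: \<alpha>_def \<theta>_def)
      then show ?case using sd(1) by simp
    next
      case (Suc n)
      have D: "real n + \<theta> > 0" using Suc.hyps \<theta> by linarith
      then have "1 + 1 / (real n + \<theta>) = (real (Suc n) + \<theta>) / (real n + \<theta>)" by (simp add: field_simps)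
      then show ?case using linear_at_Suc[OF Suc.hyps Suc.IH] D by simp
    qed
    have "\<gamma> a n = (real a - \<alpha>) / (real n + \<theta>)" if a: "1 \<le> a" "a < n" for a n
    proof (cases "n \<ge> 3")
      case True
      then show ?thesis using lin[of n] a by (simp add: linear_at_def diff_divide_distrib)
    next
      case False
      then have an: "a = 1" "n = 2" using a by auto
      have "\<gamma> 1 2 = (s + d) / (1 - d)" using sd(2,3) by (simp add: field_simps)
      also have "\<dots> = (1 - \<alpha>) / (2 + \<theta>)" using dpos sd(3) by (simp add: \<alpha>_def \<theta>_def field_simps)
      finally show ?thesis by (simp add: an)
    qed
    moreover have "\<alpha> < 1" using d dpos by (simp add: \<alpha>_def field_simps)
    ultimately show thesis using linear_rate \<theta> by blast
  qed
qed

text \<open>With at least two blocks each block is smaller than the total, so the linear formula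
  applies to all of them.\<close>

lemma add_singleton_linear:
  assumes "0 \<notin># \<mu>" "size \<mu> \<ge> 2"
    and "\<And>y. 1 \<le> y \<Longrightarrow> y < sum_mset \<mu> \<Longrightarrow> \<gamma> y (sum_mset \<mu>) = s + d * real y"
  shows "f (add_mset 1 \<mu>) = (1 - (s * size \<mu> + d * real (sum_mset \<mu>))) * f \<mu>"
proof -
  have "\<gamma> y (sum_mset \<mu>) = s + d * real y" if y: "y \<in># \<mu>" for y
  proof (rule assms(3))
    show "1 \<le> y" using y assms(1) by (cases y) auto
    have "0 \<notin># \<mu> - {#y#}" using assms(1) by (meson in_diffD)
    moreover have "\<mu> - {#y#} \<noteq> {#}"
      using assms(2) y by (metis One_nat_def Suc_1 Suc_n_not_le_n add_mset_remove_trivial_If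
        insert_DiffM size_single)
    ultimately have "sum_mset (\<mu> - {#y#}) \<ge> 1" by (rule sum_mset_pos)
    then show "y < sum_mset \<mu>" using sum_mset.remove[OF y] by simp
  qed
  then have "(\<Sum>y\<in>#\<mu>. \<gamma> y (sum_mset \<mu>)) = (\<Sum>y\<in>#\<mu>. s + d * real y)"
    by (intro arg_cong[where f = sum_mset] image_mset_cong)
  then show ?thesis using add_singleton[OF assms(1,2)] by (simp only: sum_mset_linear)
qed

lemma one_block_diff:
  assumes "n \<ge> 1"
  shows "f {#n#} - f {#Suc n#} = f {#n, 1#}"
  using addition_distinguished[OF assms, of "{#}"] by simp

section \<open>Identification of the weights from normalization and the limit\<close>

context
  assumes one: "f {#1#} = 1" and lim: "(\<lambda>n. f {#n#}) \<longlonglongrightarrow> 0" and f11: "f {#1, 1#} > 0"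
begin

text \<open>The values with at least two blocks are fixed up to a factor. The one-block values are
  tied to them by showing that (n + \<theta>) f(n, 1) = (\<theta> + \<alpha>) f(n); normalization at
  n = 1 then fixes the factor.\<close>

lemma eq_two_parameter_weight:
  assumes "\<alpha> < 1" "\<theta> > -2"
    and \<gamma>: "\<And>a n. 1 \<le> a \<Longrightarrow> a < n \<Longrightarrow> \<gamma> a n = (real a - \<alpha>) / (real n + \<theta>)"
  shows "two_parameter_range \<alpha> \<theta>"
    and "0 \<notin># \<mu> \<Longrightarrow> \<mu> \<noteq> {#} \<Longrightarrow> f \<mu> = two_parameter_weight \<alpha> \<theta> \<mu>"
proof -
  have new: "f (add_mset 1 \<mu>) = (\<theta> + real (size \<mu>) * \<alpha>) / (real (sum_mset \<mu>) + \<theta>) * f \<mu>"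
    if "0 \<notin># \<mu>" "size \<mu> \<ge> 2" for \<mu>
  proof -
    let ?n = "real (sum_mset \<mu>)"
    have "sum_mset \<mu> \<ge> 2" using size_le_sum_mset[OF that(1)] that(2) by linarith
    then have "?n \<ge> real 2" by (rule of_nat_mono)
    then have D: "?n + \<theta> > 0" using assms(2) by simp
    have eq: "1 - (- \<alpha> / D * k + 1 / D * (D - \<theta>)) = (\<theta> + k * \<alpha>) / D" if "D > 0" for k D
      using that by (simp add: field_simps)
    have "f (add_mset 1 \<mu>) = (1 - (- \<alpha> / (?n + \<theta>) * size \<mu> + 1 / (?n + \<theta>) * ?n)) * f \<mu>"
      using that by (rule add_singleton_linear) (simp add: \<gamma> diff_divide_distrib)
    then show ?thesis using eq[OF D, of "real (size \<mu>)"] by (simp only: add_diff_cancel_right')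
  qed
  define u where "u n = f {#n, 1#}" for n
  define w where "w n = (real n + \<theta>) * u n" for n
  have u_Suc: "u (Suc n) = (real n - \<alpha>) / (real (Suc n) + \<theta>) * u n" if "n \<ge> 1" for n
    using transition[of n "{#1#}"] \<gamma>[of n "Suc n"] that by (simp add: u_def)
  have u_pos: "u n > 0" if "n \<ge> 1" for n
    using that
  proof (induction n rule: nat_induct_at_least)
    case base
    then show ?case using f11 by (simp add: u_def)
  next
    case (Suc n)
    have "(real n - \<alpha>) / (real (Suc n) + \<theta>) > 0" using Suc.hyps assms(1,2) by (intro divide_pos_pos) auto
    then show ?case unfolding u_Suc[OF Suc.hyps] using Suc.IH by (rule mult_pos_pos)
  qed
  have u_diff: "u n = f {#n#} - f {#Suc n#}" if "n \<ge> 1" for n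
    using one_block_diff[OF that] by (simp add: u_def)
  \<comment> \<open>\<open>w n\<close> and \<open>(\<theta> + \<alpha>) * f {#n#}\<close> have the
    same increments, so they differ by this constant, which is also the limit of
    \<open>w\<close>.\<close>
  define K where "K = w 1 - (\<theta> + \<alpha>)"
  have w: "w n = (\<theta> + \<alpha>) * f {#n#} + K" if "n \<ge> 1" for n
    using that
  proof (induction n rule: nat_induct_at_least)
    case base
    then show ?case using one by (simp add: K_def)
  next
    case (Suc n)
    have "w (Suc n) = (real n - \<alpha>) * u n"
      using assms(2) Suc.hyps by (simp add: w_def u_Suc del: of_nat_Suc)
    also have "\<dots> = w n - (\<theta> + \<alpha>) * u n" by (simp add: w_def algebra_simps)
    finally show ?case using Suc.IH u_diff[OF Suc.hyps] by (simp add: algebra_simps)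
  qed
  have "(\<lambda>n. (\<theta> + \<alpha>) * f {#n#} + K) \<longlonglongrightarrow> (\<theta> + \<alpha>) * 0 + K"
    by (intro tendsto_intros lim)
  moreover have "eventually (\<lambda>n. (\<theta> + \<alpha>) * f {#n#} + K = w n) sequentially"
    using eventually_ge_at_top[of 1] by eventually_elim (simp add: w)
  ultimately have w_lim: "w \<longlonglongrightarrow> K" using Lim_transform_eventually by fastforce
  have w_pos: "w n > 0" if "n \<ge> 2" for n
    using u_pos[of n] that assms(2) by (simp add: w_def)
  have "K \<ge> 0" using w_lim w_pos by (intro LIMSEQ_le_const[of w K 0]) (auto intro: less_imp_le)
  \<comment> \<open>A positive limit of \<open>w\<close> would bound f(n) - f(n + 1) below by a
    multiple of 1/n for large n. These differences telescope to a convergent series, but the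
    harmonic series diverges.\<close>
  moreover have "\<not> K > 0"
  proof
    assume K: "K > 0"
    have "summable (\<lambda>n. f {#n#} - f {#Suc n#})" using lim by (rule telescope_summable')
    then have "summable (\<lambda>n. 2 * (1 + \<bar>\<theta>\<bar>) / K * (f {#n#} - f {#Suc n#}))" by (rule summable_mult)
    moreover have "eventually (\<lambda>n. norm (inverse (real n)) \<le> 2 * (1 + \<bar>\<theta>\<bar>) / K * (f {#n#} - f {#Suc n#})) sequentially"
    proof -
      have "eventually (\<lambda>n. K / 2 < w n) sequentially" using K by (intro order_tendstoD(1)[OF w_lim]) simp
      then show ?thesis using eventually_ge_at_top[of 2]
      proof eventually_elim
        case (elim n)
        have "real n + \<theta> \<le> (1 + \<bar>\<theta>\<bar>) * real n"
        proof -
          have "\<bar>\<theta>\<bar> * 1 \<le> \<bar>\<theta>\<bar> * real n" using elim by (intro mult_left_mono) auto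
          then show ?thesis by (simp add: algebra_simps)
        qed
        then have "w n \<le> (1 + \<bar>\<theta>\<bar>) * real n * u n"
          unfolding w_def using u_pos[of n] elim by (intro mult_right_mono) auto
        then have "K \<le> 2 * ((1 + \<bar>\<theta>\<bar>) * real n * u n)" using elim by linarith
        moreover have "u n = f {#n#} - f {#Suc n#}" using u_diff elim by simp
        ultimately show ?case using K elim by (simp add: field_simps)
      qed
    qed
    ultimately have "summable (\<lambda>n. inverse (real n))" 
      by (rule summable_comparison_test_ev[rotated])
    then show False using not_summable_harmonic by blast
  qed
  ultimately have K0: "K = 0" by simp
  \<comment> \<open>Evaluated at 2 because only \<theta> > -2 is known so far, which does not give
    the sign of 1 + \<theta>.\<close>
  have "(\<theta> + \<alpha>) * f {#2#} > 0" using w[of 2] w_pos[of 2] K0 by simp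
  then have \<theta>\<alpha>: "\<theta> + \<alpha> > 0" using nonneg[of "{#2#}"] by (simp add: zero_less_mult_iff)
  then have \<theta>: "\<theta> > -1" using assms(1) by simp
  have block: "f {#n#} = (real n + \<theta>) / (\<theta> + \<alpha>) * f {#n, 1#}" if "n \<ge> 1" for n
    using w[OF that] K0 \<theta>\<alpha> by (simp add: w_def u_def field_simps)
  have wblock: "two_parameter_weight \<alpha> \<theta> {#n#} =
      (real n + \<theta>) / (\<theta> + \<alpha>) * two_parameter_weight \<alpha> \<theta> {#n, 1#}" if "n \<ge> 1" for n
  proof -
    have "two_parameter_weight \<alpha> \<theta> {#n, 1#} = (\<theta> + \<alpha>) / (real n + \<theta>) * two_parameter_weight \<alpha> \<theta> {#n#}"
      using two_parameter_weight_add_1[of "{#n#}" \<alpha> \<theta>] that by (simp add: add_mset_commute)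
    moreover have "real n + \<theta> > 0" using \<theta> that by linarith
    ultimately show ?thesis using \<theta>\<alpha> by simp
  qed
  have w11: "f {#1, 1#} = two_parameter_weight \<alpha> \<theta> {#1, 1#}"
  proof -
    have "f {#1#} = two_parameter_weight \<alpha> \<theta> {#1#}"
      using one two_parameter_weight_singleton_1[of \<alpha> \<theta>] by simp
    then have "(real 1 + \<theta>) / (\<theta> + \<alpha>) * f {#1, 1#} =
        (real 1 + \<theta>) / (\<theta> + \<alpha>) * two_parameter_weight \<alpha> \<theta> {#1, 1#}"
      unfolding block[OF order_refl] wblock[OF order_refl] .
    moreover have "(real 1 + \<theta>) / (\<theta> + \<alpha>) \<noteq> 0" using \<theta> \<theta>\<alpha> by simp
    ultimately show ?thesis by (metis mult_left_cancel)
  qed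
  have ge2: "f \<mu> = two_parameter_weight \<alpha> \<theta> \<mu>" if "0 \<notin># \<mu>" "size \<mu> \<ge> 2" for \<mu>
  proof (rule prediction_rule_unique[where f = f and h = "two_parameter_weight \<alpha> \<theta>"
        and g = "\<lambda>a \<rho>. (real a - \<alpha>) / (real (a + sum_mset \<rho>) + \<theta>)"
        and k = "\<lambda>\<mu>. (\<theta> + real (size \<mu>) * \<alpha>) / (real (sum_mset \<mu>) + \<theta>)", OF _ _ _ _ w11 that])
    fix a :: nat and \<rho> :: "nat multiset" assume a: "a \<ge> 1" and \<rho>: "0 \<notin># \<rho>" "\<rho> \<noteq> {#}"
    show "f (add_mset (Suc a) \<rho>) = (real a - \<alpha>) / (real (a + sum_mset \<rho>) + \<theta>) * f (add_mset a \<rho>)"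
      using transition[OF a \<rho>] \<gamma>[of a "a + sum_mset \<rho>"] a sum_mset_pos[OF \<rho>] by simp
    show "two_parameter_weight \<alpha> \<theta> (add_mset (Suc a) \<rho>) =
        (real a - \<alpha>) / (real (a + sum_mset \<rho>) + \<theta>) * two_parameter_weight \<alpha> \<theta> (add_mset a \<rho>)"
      using a by (rule two_parameter_weight_Suc)
  next
    fix \<mu> :: "nat multiset" assume \<mu>: "0 \<notin># \<mu>" "size \<mu> \<ge> 2"
    show "f (add_mset 1 \<mu>) = (\<theta> + real (size \<mu>) * \<alpha>) / (real (sum_mset \<mu>) + \<theta>) * f \<mu>"
      using \<mu> by (rule new)
    show "two_parameter_weight \<alpha> \<theta> (add_mset 1 \<mu>) =
        (\<theta> + real (size \<mu>) * \<alpha>) / (real (sum_mset \<mu>) + \<theta>) * two_parameter_weight \<alpha> \<theta> \<mu>"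
      using \<mu> by (intro two_parameter_weight_add_1) auto
  qed
  show "f \<mu> = two_parameter_weight \<alpha> \<theta> \<mu>" if \<mu>: "0 \<notin># \<mu>" "\<mu> \<noteq> {#}" for \<mu>
  proof (cases "size \<mu> \<ge> 2")
    case True
    then show ?thesis using ge2 \<mu> by blast
  next
    case False
    then have "size \<mu> = 1" using \<mu>(2) by (metis One_nat_def less_2_cases not_le size_eq_0_iff_empty)
    then obtain n where n: "\<mu> = {#n#}" using size_1_singleton_mset by blast
    then have "n \<ge> 1" using \<mu>(1) by (cases n) auto
    moreover have "f {#n, 1#} = two_parameter_weight \<alpha> \<theta> {#n, 1#}"
      using \<open>n \<ge> 1\<close> by (intro ge2) auto
    ultimately show ?thesis unfolding n block[OF \<open>n \<ge> 1\<close>] wblock[OF \<open>n \<ge> 1\<close>] by simp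
  qed
  show "two_parameter_range \<alpha> \<theta>"
  proof (cases "\<alpha> \<ge> 0")
    case True
    then show ?thesis using assms(1) \<theta>\<alpha> by (simp add: two_parameter_range_def)
  next
    case False
    \<comment> \<open>For negative \<alpha> the numerators of the new-block probabilities become
      negative eventually. If none vanished, all values at singletons would be positive and the next
      value after a negative numerator would be negative. The offset 2 guarantees two
      blocks.\<close>
    have "\<exists>k\<ge>2. \<theta> + real k * \<alpha> = 0"
    proof (rule ccontr)
      assume nz: "\<not> ?thesis"
      have pos: "f (replicate_mset k 1) > 0" if "k \<ge> 2" for k
        using that
      proof (induction k rule: nat_induct_at_least)
        case base
        then show ?case using f11 by (simp add: eval_nat_numeral)
      next
        case (Suc k)
        have "real k + \<theta> > 0" using Suc.hyps assms(2) by linarith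
        then have "f (replicate_mset (Suc k) 1) \<noteq> 0"
          using new[of "replicate_mset k 1"] Suc nz by auto
        then show ?case using nonneg[of "replicate_mset (Suc k) 1"] by linarith
      qed
      obtain k :: nat where k: "\<theta> < real k * (- \<alpha>)" using reals_Archimedean3[of "- \<alpha>"] False by (meson neg_0_less_iff_less not_le)
      have "real (k + 2) * (- \<alpha>) > \<theta>" using k False by (simp add: algebra_simps)
      then have "\<theta> + real (k + 2) * \<alpha> < 0" by simp
      moreover have "real (k + 2) + \<theta> > 0" using assms(2) by simp
      ultimately have "(\<theta> + real (k + 2) * \<alpha>) / (real (k + 2) + \<theta>) < 0" by (rule divide_neg_pos)
      then have "(\<theta> + real (k + 2) * \<alpha>) / (real (k + 2) + \<theta>) * f (replicate_mset (k + 2) 1) < 0"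
        using pos[of "k + 2"] by (intro mult_neg_pos) auto
      also have "(\<theta> + real (k + 2) * \<alpha>) / (real (k + 2) + \<theta>) * f (replicate_mset (k + 2) 1) =
          f (add_mset 1 (replicate_mset (k + 2) 1))"
        using new[of "replicate_mset (k + 2) 1"] by simp
      finally show False using nonneg[of "add_mset 1 (replicate_mset (k + 2) 1)"] by linarith
    qed
    then obtain k where "k \<ge> 2" "\<theta> + real k * \<alpha> = 0" by blast
    then have "k \<ge> 1 \<and> \<theta> = - real k * \<alpha>" by simp
    then show ?thesis using False unfolding two_parameter_range_def by (intro disjI2 conjI) auto
  qed
qed

text \<open>Nonnegativity at partitions into singletons forces some new-block probability 1 - k s to
  vanish, so that s = 1/M. The limit then gives f(n, 1) = (1 - s) f(n), from which the remaining
  factor follows.\<close>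

lemma eq_coupon_weight:
  assumes "s > 0" and \<gamma>: "\<And>a n. 1 \<le> a \<Longrightarrow> a < n \<Longrightarrow> \<gamma> a n = s"
  obtains M where "M \<ge> 1" "\<And>\<mu>. 0 \<notin># \<mu> \<Longrightarrow> \<mu> \<noteq> {#} \<Longrightarrow> f \<mu> = coupon_weight M \<mu>"
proof -
  have new: "f (add_mset 1 \<mu>) = (1 - real (size \<mu>) * s) * f \<mu>" if "0 \<notin># \<mu>" "size \<mu> \<ge> 2" for \<mu>
    using add_singleton_linear[OF that, of s 0] \<gamma> by (simp add: mult.commute)
  have "\<exists>k\<ge>2. 1 - real k * s = 0"
  proof (rule ccontr)
    assume nz: "\<not> ?thesis"
    have pos: "f (replicate_mset k 1) > 0" if "k \<ge> 2" for k
      using that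
    proof (induction k rule: nat_induct_at_least)
      case base
      then show ?case using f11 by (simp add: eval_nat_numeral)
    next
      case (Suc k)
      then have "f (replicate_mset (Suc k) 1) \<noteq> 0"
        using new[of "replicate_mset k 1"] nz by auto
      then show ?case using nonneg[of "replicate_mset (Suc k) 1"] by linarith
    qed
    obtain k :: nat where k: "1 < real k * s" using reals_Archimedean3[OF assms(1)] by blast
    then have "1 - real (k + 2) * s < 0" using assms(1) by (simp add: algebra_simps)
    then have "(1 - real (k + 2) * s) * f (replicate_mset (k + 2) 1) < 0"
      using pos[of "k + 2"] by (intro mult_neg_pos) auto
    also have "(1 - real (k + 2) * s) * f (replicate_mset (k + 2) 1) =
        f (add_mset 1 (replicate_mset (k + 2) 1))"
      using new[of "replicate_mset (k + 2) 1"] by simp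
    finally show False using nonneg[of "add_mset 1 (replicate_mset (k + 2) 1)"] by linarith
  qed
  then obtain M where M: "M \<ge> 2" "real M * s = 1" by auto
  have s: "s = 1 / real M" using M by (simp add: field_simps)
  have s1: "s < 1" using M by (simp add: s)
  \<comment> \<open>The defect of the desired relation. It is constant in \<open>n\<close>, and it
    tends to 0 because \<open>f {#n, 1#}\<close> is the difference of consecutive one-block
    values.\<close>
  define v where "v n = f {#n, 1#} - (1 - s) * f {#n#}" for n
  have v: "v n = v 1" if "n \<ge> 1" for n
    using that
  proof (induction n rule: nat_induct_at_least)
    case (Suc n)
    have "f {#Suc n, 1#} = s * f {#n, 1#}"
      using transition[of n "{#1#}"] \<gamma>[of n "Suc n"] Suc.hyps by simp
    then have "v (Suc n) = v n"
      using one_block_diff[OF Suc.hyps] unfolding v_def by (simp add: algebra_simps)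
    then show ?case using Suc.IH by simp
  qed simp
  have "(\<lambda>n. f {#n#} - f {#Suc n#} - (1 - s) * f {#n#}) \<longlonglongrightarrow> 0 - 0 - (1 - s) * 0"
    by (intro tendsto_intros lim LIMSEQ_Suc[OF lim])
  moreover have "eventually (\<lambda>n. f {#n#} - f {#Suc n#} - (1 - s) * f {#n#} = v 1) sequentially"
    using eventually_ge_at_top[of 1]
  proof eventually_elim
    case (elim n)
    then show ?case using v[OF elim] one_block_diff[OF elim] by (simp add: v_def)
  qed
  ultimately have "(\<lambda>n. v 1) \<longlonglongrightarrow> 0" using Lim_transform_eventually by fastforce
  then have v0: "v 1 = 0" by (simp add: LIMSEQ_const_iff)
  have block: "f {#n#} = f {#n, 1#} / (1 - s)" if "n \<ge> 1" for n
    using v[OF that] v0 s1 by (simp add: v_def field_simps)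
  have wblock: "coupon_weight M {#n#} = coupon_weight M {#n, 1#} / (1 - s)" for n
  proof -
    have "coupon_weight M {#n, 1#} = (1 - s) * coupon_weight M {#n#}"
      using coupon_weight_add_1[of M "{#n#}"] M by (simp add: s add_mset_commute)
    then show ?thesis using s1 by simp
  qed
  have w11: "f {#1, 1#} = coupon_weight M {#1, 1#}"
    using block[of 1] wblock[of 1] one coupon_weight_singleton_1[of M] M s1 by simp
  have ge2: "f \<mu> = coupon_weight M \<mu>" if "0 \<notin># \<mu>" "size \<mu> \<ge> 2" for \<mu>
  proof (rule prediction_rule_unique[where f = f and h = "coupon_weight M"
        and g = "\<lambda>a \<rho>. 1 / real M" and k = "\<lambda>\<mu>. 1 - real (size \<mu>) * (1 / real M)", OF _ _ _ _ w11 that])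
    fix a :: nat and \<rho> :: "nat multiset" assume a: "a \<ge> 1" and \<rho>: "0 \<notin># \<rho>" "\<rho> \<noteq> {#}"
    show "f (add_mset (Suc a) \<rho>) = 1 / real M * f (add_mset a \<rho>)"
      using transition[OF a \<rho>] \<gamma>[of a "a + sum_mset \<rho>"] a sum_mset_pos[OF \<rho>] by (simp add: s)
    show "coupon_weight M (add_mset (Suc a) \<rho>) = 1 / real M * coupon_weight M (add_mset a \<rho>)"
      by (rule coupon_weight_Suc)
  next
    fix \<mu> :: "nat multiset" assume \<mu>: "0 \<notin># \<mu>" "size \<mu> \<ge> 2"
    show "f (add_mset 1 \<mu>) = (1 - real (size \<mu>) * (1 / real M)) * f \<mu>"
      using new[OF \<mu>] by (simp only: s)
    show "coupon_weight M (add_mset 1 \<mu>) = (1 - real (size \<mu>) * (1 / real M)) * coupon_weight M \<mu>"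
      using M by (intro coupon_weight_add_1) simp
  qed
  show thesis
  proof (rule that[of M])
    show "M \<ge> 1" using M by simp
    fix \<mu> :: "nat multiset" assume \<mu>: "0 \<notin># \<mu>" "\<mu> \<noteq> {#}"
    show "f \<mu> = coupon_weight M \<mu>"
    proof (cases "size \<mu> \<ge> 2")
      case True
      then show ?thesis using ge2 \<mu> by blast
    next
      case False
      then have "size \<mu> = 1" using \<mu>(2) by (metis One_nat_def less_2_cases not_le size_eq_0_iff_empty)
      then obtain n where n: "\<mu> = {#n#}" using size_1_singleton_mset by blast
      then have "n \<ge> 1" using \<mu>(1) by (cases n) auto
      moreover have "f {#n, 1#} = coupon_weight M {#n, 1#}"
        using \<open>n \<ge> 1\<close> by (intro ge2) auto
      ultimately show ?thesis unfolding n block[OF \<open>n \<ge> 1\<close>] wblock by simp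
    qed
  qed
qed

end

end

end

section \<open>The characterization\<close>

lemma all_compositions_iff:
  "(\<forall>l. composition l \<longrightarrow> Q (mset l)) \<longleftrightarrow> (\<forall>\<mu>. 0 \<notin># \<mu> \<longrightarrow> \<mu> \<noteq> {#} \<longrightarrow> Q \<mu>)"
proof (intro iffI allI impI)
  fix \<mu> :: "nat multiset" assume "\<forall>l. composition l \<longrightarrow> Q (mset l)" "0 \<notin># \<mu>" "\<mu> \<noteq> {#}"
  moreover obtain l where "mset l = \<mu>" using ex_mset by blast
  ultimately show "Q \<mu>" unfolding composition_def by (metis mset.simps(1) set_mset_mset)
qed (auto simp: composition_def)

lemma extended_two_parameter_family_iff:
  assumes "\<forall>l. composition l \<longrightarrow> p l = f (mset l)"
  shows "extended_two_parameter_family p \<longleftrightarrow>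
    (\<exists>\<alpha> \<theta>. two_parameter_range \<alpha> \<theta> \<and>
      (\<forall>\<mu>. 0 \<notin># \<mu> \<longrightarrow> \<mu> \<noteq> {#} \<longrightarrow> f \<mu> = two_parameter_weight \<alpha> \<theta> \<mu>)) \<or>
    (\<exists>M\<ge>1. \<forall>\<mu>. 0 \<notin># \<mu> \<longrightarrow> \<mu> \<noteq> {#} \<longrightarrow> f \<mu> = coupon_weight M \<mu>)"
proof -
  have "(\<forall>l. composition l \<longrightarrow> p l = w (mset l)) \<longleftrightarrow> (\<forall>\<mu>. 0 \<notin># \<mu> \<longrightarrow> \<mu> \<noteq> {#} \<longrightarrow> f \<mu> = w \<mu>)" for w
    unfolding all_compositions_iff[symmetric] using assms by auto
  then show ?thesis
    by (simp only: extended_two_parameter_family_def two_parameter_EPPF_eq_weight coupon_EPPF_eq_weight)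
qed

lemma is_EPPF_iff_eppf:
  assumes "\<forall>n\<ge>1. random_partition n (\<pi> n)"
  shows "is_EPPF \<pi> (\<lambda>l. w (mset l)) \<longleftrightarrow> (\<forall>\<mu>. 0 \<notin># \<mu> \<longrightarrow> \<mu> \<noteq> {#} \<longrightarrow> eppf \<pi> \<mu> = w \<mu>)"
  unfolding is_EPPF_iff[OF assms] all_compositions_iff[symmetric] by (auto simp: eq_commute)

lemma color_deletion_imp_extended_two_parameter:
  assumes ps: "partition_structure \<pi>" and cdp: "color_deletion_property \<pi> \<pi>'"
    and pos: "eppf \<pi> {#2, 2, 1#} > 0" and lim: "(\<lambda>n. eppf \<pi> {#n#}) \<longlonglongrightarrow> 0"
  shows "(\<exists>\<alpha> \<theta>. two_parameter_range \<alpha> \<theta> \<and>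
      (\<forall>\<mu>. 0 \<notin># \<mu> \<longrightarrow> \<mu> \<noteq> {#} \<longrightarrow> eppf \<pi> \<mu> = two_parameter_weight \<alpha> \<theta> \<mu>)) \<or>
    (\<exists>M\<ge>1. \<forall>\<mu>. 0 \<notin># \<mu> \<longrightarrow> \<mu> \<noteq> {#} \<longrightarrow> eppf \<pi> \<mu> = coupon_weight M \<mu>)"
proof -
  obtain Z where Z: "\<And>m \<rho>. m \<ge> 1 \<Longrightarrow> 0 \<notin># \<rho> \<Longrightarrow> \<rho> \<noteq> {#} \<Longrightarrow>
      eppf \<pi> (add_mset m \<rho>) = Z m (sum_mset \<rho>) * eppf \<pi>' \<rho>"
    using cdp unfolding color_deletion_property_iff[OF ps] by metis
  \<comment> \<open>The other blocks contain \<open>n - a\<close> balls, and their common factor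
    cancels in the ratio. Where the denominator is 0, \<open>\<gamma>\<close> is 0 and both values
    of the EPPF vanish by monotonicity.\<close>
  define \<gamma> where "\<gamma> a n = Z (Suc a) (n - a) / Z a (n - a)" for a n
  note nonneg = eppf_nonneg[of \<pi>] and addition = eppf_addition_rule[OF ps]
  have transition: "eppf \<pi> (add_mset (Suc a) \<rho>) = \<gamma> a (a + sum_mset \<rho>) * eppf \<pi> (add_mset a \<rho>)"
    if "a \<ge> 1" "0 \<notin># \<rho>" "\<rho> \<noteq> {#}" for a \<rho>
  proof (cases "Z a (sum_mset \<rho>) = 0")
    case True
    then have "eppf \<pi> (add_mset a \<rho>) = 0" using Z that by simp
    then show ?thesis
      using add_block_Suc_le[OF nonneg addition that(1,2)] nonneg[of "add_mset (Suc a) \<rho>"] by simp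
  next
    case False
    then show ?thesis using Z[OF that] Z[of "Suc a" \<rho>] that by (simp add: \<gamma>_def)
  qed
  have one: "eppf \<pi> {#1#} = 1"
  proof -
    have "random_partition 1 (\<pi> 1)" using ps by (simp add: partition_structure_def)
    then have "(\<Sum>\<mu>\<in>partitions_of 1. type_count \<mu> * eppf \<pi> \<mu>) = 1" by (rule total_mass_eppf)
    then show ?thesis using total_mass_of_addition_rule[OF addition, of 1] by simp
  qed
  note f11 = small_positive(4)[OF nonneg addition transition pos]
  show ?thesis
  proof (rule transition_closed_form[OF nonneg addition transition pos])
    fix \<alpha> \<theta> assume "\<alpha> < 1" "\<theta> > -2" "\<And>a n. 1 \<le> a \<Longrightarrow> a < n \<Longrightarrow> \<gamma> a n = (real a - \<alpha>) / (real n + \<theta>)"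
    from eq_two_parameter_weight[OF nonneg addition transition one lim f11 this]
    show ?thesis by blast
  next
    fix s :: real assume "s > 0" "\<And>a n. 1 \<le> a \<Longrightarrow> a < n \<Longrightarrow> \<gamma> a n = s"
    note * = eq_coupon_weight[OF nonneg addition transition one lim f11 this]
    show ?thesis by (rule *) blast+
  qed
qed

theorem theorem3:
  fixes \<pi> :: "nat \<Rightarrow> nat multiset pmf" and p :: "nat list \<Rightarrow> real"
  assumes "partition_structure \<pi>"
    and "is_EPPF \<pi> p"
    and "p [2, 2, 1] > 0"
    and "(\<lambda>n. p [n]) \<longlonglongrightarrow> 0"
  shows "(extended_two_parameter_family p \<longleftrightarrow> (\<exists>\<pi>'. color_deletion_property \<pi> \<pi>')) \<and>
    (\<forall>\<pi>'. color_deletion_property \<pi> \<pi>' \<longrightarrow>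
       (\<forall>\<alpha> \<theta>. two_parameter_range \<alpha> \<theta> \<and> is_EPPF \<pi> (two_parameter_EPPF \<alpha> \<theta>) \<longrightarrow>
          is_EPPF \<pi>' (two_parameter_EPPF \<alpha> (\<theta> + \<alpha>))) \<and>
       (\<forall>M::nat. M \<ge> 1 \<and> is_EPPF \<pi> (coupon_EPPF M) \<longrightarrow>
          is_EPPF \<pi>' (coupon_EPPF (M - 1))))"
proof -
  note ps = assms(1)
  have rp: "\<forall>n\<ge>1. random_partition n (\<pi> n)"
    using ps by (simp add: partition_structure_def)
  have p: "\<forall>l. composition l \<longrightarrow> p l = eppf \<pi> (mset l)"
    using assms(2) unfolding is_EPPF_iff[OF rp] .
  have pos: "eppf \<pi> {#2, 2, 1#} > 0"
    using assms(3) p[rule_format, of "[2, 2, 1]"] by (simp add: composition_def)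
  have f11: "eppf \<pi> {#1, 1#} > 0"
  proof -
    have "eppf \<pi> {#1, 2, 1#} > 0"
      using add_block_Suc_le[OF eppf_nonneg eppf_addition_rule[OF ps], of 1 "{#2, 1#}"] pos
      by (simp add: eval_nat_numeral)
    then have "eppf \<pi> {#2, 1#} > 0"
      using add_singleton_le[OF eppf_nonneg eppf_addition_rule[OF ps], of "{#2, 1#}"] by simp
    then show ?thesis
      using add_block_Suc_le[OF eppf_nonneg eppf_addition_rule[OF ps], of 1 "{#1#}"]
      by (simp add: eval_nat_numeral)
  qed
  have lim: "(\<lambda>n. eppf \<pi> {#n#}) \<longlonglongrightarrow> 0"
  proof (rule Lim_transform_eventually[OF assms(4)])
    show "eventually (\<lambda>n. p [n] = eppf \<pi> {#n#}) sequentially"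
      using eventually_ge_at_top[of 1] by eventually_elim (simp add: p composition_def)
  qed
  have tp: "two_parameter_EPPF \<alpha> \<theta> = (\<lambda>l. two_parameter_weight \<alpha> \<theta> (mset l))" for \<alpha> \<theta>
    by (rule ext) (rule two_parameter_EPPF_eq_weight)
  have cp: "coupon_EPPF M = (\<lambda>l. coupon_weight M (mset l))" for M
    by (rule ext) (rule coupon_EPPF_eq_weight)
  show ?thesis
  proof (intro conjI iffI allI impI; (elim conjE)?)
    assume "extended_two_parameter_family p"
    then consider \<alpha> \<theta> where "two_parameter_range \<alpha> \<theta>"
        "\<And>\<mu>. 0 \<notin># \<mu> \<Longrightarrow> \<mu> \<noteq> {#} \<Longrightarrow> eppf \<pi> \<mu> = two_parameter_weight \<alpha> \<theta> \<mu>"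
      | M where "M \<ge> 1" "\<And>\<mu>. 0 \<notin># \<mu> \<Longrightarrow> \<mu> \<noteq> {#} \<Longrightarrow> eppf \<pi> \<mu> = coupon_weight M \<mu>"
      unfolding extended_two_parameter_family_iff[OF p] by metis
    then show "\<exists>\<pi>'. color_deletion_property \<pi> \<pi>'"
      using two_parameter_weight_color_deletion(1)[OF ps _ _ f11]
        coupon_weight_color_deletion(1)[OF ps _ _ f11]
      by cases blast+
  next
    assume "\<exists>\<pi>'. color_deletion_property \<pi> \<pi>'"
    then show "extended_two_parameter_family p"
      unfolding extended_two_parameter_family_iff[OF p]
      using color_deletion_imp_extended_two_parameter[OF ps _ pos lim] by blast
  next
    fix \<pi>' \<alpha> \<theta> assume cdp: "color_deletion_property \<pi> \<pi>'" and range: "two_parameter_range \<alpha> \<theta>"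
      and eppf: "is_EPPF \<pi> (two_parameter_EPPF \<alpha> \<theta>)"
    have rp': "\<forall>r\<ge>1. random_partition r (\<pi>' r)"
      using cdp by (simp add: color_deletion_property_def)
    have eq: "eppf \<pi> \<mu> = two_parameter_weight \<alpha> \<theta> \<mu>" if "0 \<notin># \<mu>" "\<mu> \<noteq> {#}" for \<mu>
      using eppf that unfolding tp is_EPPF_iff_eppf[OF rp] by blast
    show "is_EPPF \<pi>' (two_parameter_EPPF \<alpha> (\<theta> + \<alpha>))"
      unfolding tp is_EPPF_iff_eppf[OF rp']
      using two_parameter_weight_color_deletion(2)[OF ps range eq f11 cdp] by blast
  next
    fix \<pi>' and M :: nat assume cdp: "color_deletion_property \<pi> \<pi>'" and M: "M \<ge> 1"
      and eppf: "is_EPPF \<pi> (coupon_EPPF M)"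
    have rp': "\<forall>r\<ge>1. random_partition r (\<pi>' r)"
      using cdp by (simp add: color_deletion_property_def)
    have eq: "eppf \<pi> \<mu> = coupon_weight M \<mu>" if "0 \<notin># \<mu>" "\<mu> \<noteq> {#}" for \<mu>
      using eppf that unfolding cp is_EPPF_iff_eppf[OF rp] by blast
    show "is_EPPF \<pi>' (coupon_EPPF (M - 1))"
      unfolding cp is_EPPF_iff_eppf[OF rp']
      using coupon_weight_color_deletion(2)[OF ps M eq f11 cdp] by blast
  qed
qed

end
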